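(* $\mathsf{S}_2^{\mathsf{P}}$-Search is equivalent to $\mathsf{TFNP}^{\mathsf{NP}}$. That is: (1) for every $\mathsf{S}_2^{\mathsf{P}}$ predicate $P$ (with associated polynomial $q$), the search problem $\mathsf{S}_2^{\mathsf{P}}$-Search for $P$ is in $\mathsf{TFNP}^{\mathsf{NP}}$; and (2) for every relation $R \in \mathsf{TFNP}^{\mathsf{NP}}$, there is an $\mathsf{S}_2^{\mathsf{P}}$ predicate $Q$ such that the search problem of $R$ reduces, by a polynomial-time many-one search reduction, to $\mathsf{S}_2^{\mathsf{P}}$-Search for $Q$.
   Context: All strings are over $\{0,1\}$. $\mathsf{S}_2^{\mathsf{P}}$: A language $L$ is in $\mathsf{S}_2^{\mathsf{P}}$ if there exist a polynomial-time predicate $P$ and a polynomial $q$ such that, for every string $x$: - if $x \in L$, then $\exists y \in \{0,1\}^{q(|x|)}\ \forall z \in \{0,1\}^{q(|x|)}\ P(x,y,z)=1$; - if $x \notin L$, then $\exists z \in \{0,1\}^{q(|x|)}\ \forall y \in \{0,1\}^{q(|x|)}\ P(x,y,z)=0$. An "$\mathsf{S}_2^{\mathsf{P}}$ predicate" is a polynomial-time predicate $P$ that, together with some polynomial $q$, defines a language $L \in \mathsf{S}_2^{\mathsf{P}}$ in this way. (Equivalently, for every $x$ one of the two displayed existential statements holds.) $\mathsf{S}_2^{\mathsf{P}}$-Search for $P$: given $x$, output either a string $y \in \{0,1\}^{q(|x|)}$, marked as a first-player witness, such that $P(x,y,z)=1$ for all $z \in \{0,1\}^{q(|x|)}$, or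 a string $z \in \{0,1\}^{q(|x|)}$, marked as a second-player witness, such that $P(x,y,z)=0$ for all $y \in \{0,1\}^{q(|x|)}$. As a relation, its pairs are $(x,(b,w))$ with $b\in\{1,2\}$ indicating which type of witness $w$ is. $\mathsf{TFNP}^{\mathsf{NP}}$: A binary relation $R(x,y)$ is in $\mathsf{TFNP}^{\mathsf{NP}}$ if $R$ is decidable in polynomial time with an $\mathsf{NP}$ oracle (i.e. $R \in \mathsf{P}^{\mathsf{NP}}$), for every $x$ there exists $y$ such that $R(x,y)$ holds, and the length of $y$ is bounded by a polynomial in the length of $x$. The search problem of $R$ is: given $x$, find $y$ with $R(x,y)$. Polynomial-time many-one search reduction: the search problem of a relation $R$ reduces to that of a relation $S$ if there are polynomial-time computable functions $f,g$ such that for every $x$ and every $w$ with $S(f(x),w)$, we have $R(x,g(x,w))$. *)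

theory Defs
  imports Main "HOL-Computational_Algebra.Polynomial"
begin

type_synonym bits = "bool list"

text \<open>
  Time is measured on structured programs for a machine with finitely many stacks of bits (every
  program mentions only finitely many registers). A step pushes or pops one bit, inspects one top
  symbol, or asks one oracle query; hence a step is a bounded number of steps of a multi-tape
  (oracle) Turing machine and vice versa (a tape is two stacks), up to polynomial overhead.
\<close>

datatype test = NonEmpty nat | TopOne nat

datatype com =
    Skip
  | Push nat bool
  | Pop nat
  | Query nat
  | Seq com com
  | If test com com
  | While test com

type_synonym store = "nat \<Rightarrow> bits"

fun holds :: "test \<Rightarrow> store \<Rightarrow> bool" where
  "holds (NonEmpty r) s \<longleftrightarrow> s r \<noteq> []"
| "holds (TopOne r) s \<longleftrightarrow> (\<exists>w. s r = True # w)"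

text \<open>
  The query instruction replaces the query string by the one-bit answer, at unit cost.
\<close>

inductive exec :: "bits set \<Rightarrow> com \<Rightarrow> store \<Rightarrow> nat \<Rightarrow> store \<Rightarrow> bool" for A where
  Skip: "exec A Skip s 1 s"
| Push: "exec A (Push r b) s 1 (s(r := b # s r))"
| Pop: "exec A (Pop r) s 1 (s(r := tl (s r)))"
| Query: "exec A (Query r) s 1 (s(r := [s r \<in> A]))"
| Seq: "exec A c s t s' \<Longrightarrow> exec A d s' t' s'' \<Longrightarrow> exec A (Seq c d) s (t + t') s''"
| IfTrue: "holds b s \<Longrightarrow> exec A c s t s' \<Longrightarrow> exec A (If b c d) s (Suc t) s'"
| IfFalse: "\<not> holds b s \<Longrightarrow> exec A d s t s' \<Longrightarrow> exec A (If b c d) s (Suc t) s'"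
| WhileFalse: "\<not> holds b s \<Longrightarrow> exec A (While b c) s 1 s"
| WhileTrue: "holds b s \<Longrightarrow> exec A c s t s' \<Longrightarrow> exec A (While b c) s' t' s'' \<Longrightarrow>
    exec A (While b c) s (Suc (t + t')) s''"

inductive_cases exec_elims:
  "exec A Skip s t s'" "exec A (Push r b) s t s'" "exec A (Pop r) s t s'"
  "exec A (Query r) s t s'" "exec A (Seq c d) s t s'" "exec A (If b c d) s t s'"
  "exec A (While b c) s t s'"

lemma exec_deterministic:
  "exec A c s t s' \<Longrightarrow> exec A c s u s'' \<Longrightarrow> u = t \<and> s'' = s'"
proof (induction arbitrary: u s'' rule: exec.induct)
  case (Seq c s t s' d t' s2)
  from Seq.prems obtain t1 s1 t2 where
    1: "exec A c s t1 s1" and 2: "exec A d s1 t2 s''" and 3: "u = t1 + t2"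
    by (rule exec_elims(5))
  from Seq.IH(1)[OF 1] have 4: "t1 = t" "s1 = s'" by simp_all
  from Seq.IH(2)[OF 2[unfolded 4]] show ?case using 3 4 by simp
next
  case (IfTrue b s c t s' d)
  from IfTrue.prems obtain t1 where 1: "exec A c s t1 s''" and "u = Suc t1"
    by (rule exec_elims(6)) (use IfTrue.hyps(1) in simp_all)
  with IfTrue.IH[OF 1] show ?case by simp
next
  case (IfFalse b s d t s' c)
  from IfFalse.prems obtain t1 where 1: "exec A d s t1 s''" and "u = Suc t1"
    by (rule exec_elims(6)) (use IfFalse.hyps(1) in simp_all)
  with IfFalse.IH[OF 1] show ?case by simp
next
  case (WhileFalse b s c)
  from WhileFalse.prems show ?case
    by (rule exec_elims(7)) (use WhileFalse.hyps in simp_all)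
next
  case (WhileTrue b s c t s' t' s2)
  from WhileTrue.prems obtain t1 s1 t2 where
    1: "exec A c s t1 s1" and 2: "exec A (While b c) s1 t2 s''" and 3: "u = Suc (t1 + t2)"
    by (rule exec_elims(7)) (use WhileTrue.hyps(1) in simp_all)
  from WhileTrue.IH(1)[OF 1] have 4: "t1 = t" "s1 = s'" by simp_all
  from WhileTrue.IH(2)[OF 2[unfolded 4]] show ?case using 3 4 by simp
qed (erule exec_elims; simp)+

fun oracle_free :: "com \<Rightarrow> bool" where
  "oracle_free (Query r) \<longleftrightarrow> False"
| "oracle_free (Seq c d) \<longleftrightarrow> oracle_free c \<and> oracle_free d"
| "oracle_free (If b c d) \<longleftrightarrow> oracle_free c \<and> oracle_free d"
| "oracle_free (While b c) \<longleftrightarrow> oracle_free c"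
| "oracle_free _ \<longleftrightarrow> True"

text \<open>
  The \<open>i\<close>-th argument is supplied in register \<open>i\<close>, and the result is read from register 0.
  Time is polynomial in the total length of the arguments.
\<close>

definition input :: "bits list \<Rightarrow> store" where
  "input xs = (\<lambda>r. if r < length xs then xs ! r else [])"

definition computes_polytime :: "bits set \<Rightarrow> com \<Rightarrow> nat \<Rightarrow> (bits list \<Rightarrow> bits) \<Rightarrow> bool" where
  "computes_polytime A c n F \<longleftrightarrow> (\<exists>p :: nat poly. \<forall>xs. length xs = n \<longrightarrow>
     (\<exists>t s. exec A c (input xs) t s \<and> s 0 = F xs \<and> t \<le> poly p (sum_list (map length xs))))"

text \<open>The oracle argument \<open>{}\<close> is immaterial for oracle-free programs.\<close>

definition polytime :: "nat \<Rightarrow> (bits list \<Rightarrow> bits) \<Rightarrow> bool" where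
  "polytime n F \<longleftrightarrow> (\<exists>c. oracle_free c \<and> computes_polytime {} c n F)"

definition polytime_fun1 :: "(bits \<Rightarrow> bits) \<Rightarrow> bool" where
  "polytime_fun1 f \<longleftrightarrow> polytime 1 (\<lambda>xs. f (xs ! 0))"

definition polytime_fun2 :: "(bits \<Rightarrow> bits \<Rightarrow> bits) \<Rightarrow> bool" where
  "polytime_fun2 g \<longleftrightarrow> polytime 2 (\<lambda>xs. g (xs ! 0) (xs ! 1))"

definition polytime_pred2 :: "(bits \<Rightarrow> bits \<Rightarrow> bool) \<Rightarrow> bool" where
  "polytime_pred2 V \<longleftrightarrow> polytime 2 (\<lambda>xs. [V (xs ! 0) (xs ! 1)])"

definition polytime_pred3 :: "(bits \<Rightarrow> bits \<Rightarrow> bits \<Rightarrow> bool) \<Rightarrow> bool" where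
  "polytime_pred3 P \<longleftrightarrow> polytime 3 (\<lambda>xs. [P (xs ! 0) (xs ! 1) (xs ! 2)])"

definition NP :: "bits set set" where
  "NP = {A. \<exists>V. \<exists>p :: nat poly. polytime_pred2 V \<and>
     (\<forall>x. x \<in> A \<longleftrightarrow> (\<exists>y. length y \<le> poly p (length x) \<and> V x y))}"

definition P_NP_rel :: "(bits \<Rightarrow> bits \<Rightarrow> bool) \<Rightarrow> bool" where
  "P_NP_rel R \<longleftrightarrow> (\<exists>A \<in> NP. \<exists>c. computes_polytime A c 2 (\<lambda>xs. [R (xs ! 0) (xs ! 1)]))"

definition TFNP_NP :: "(bits \<Rightarrow> bits \<Rightarrow> bool) \<Rightarrow> bool" where
  "TFNP_NP R \<longleftrightarrow> P_NP_rel R \<and> (\<forall>x. \<exists>y. R x y) \<and>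
     (\<exists>p :: nat poly. \<forall>x y. R x y \<longrightarrow> length y \<le> poly p (length x))"

definition S2P_defines :: "(bits \<Rightarrow> bits \<Rightarrow> bits \<Rightarrow> bool) \<Rightarrow> nat poly \<Rightarrow> bits set \<Rightarrow> bool" where
  "S2P_defines P q L \<longleftrightarrow> polytime_pred3 P \<and>
     (\<forall>x. (x \<in> L \<longrightarrow> (\<exists>y. length y = poly q (length x) \<and>
                        (\<forall>z. length z = poly q (length x) \<longrightarrow> P x y z))) \<and>
          (x \<notin> L \<longrightarrow> (\<exists>z. length z = poly q (length x) \<and>
                        (\<forall>y. length y = poly q (length x) \<longrightarrow> \<not> P x y z))))"

definition S2P :: "bits set set" where
  "S2P = {L. \<exists>P q. S2P_defines P q L}"

definition S2P_predicate :: "(bits \<Rightarrow> bits \<Rightarrow> bits \<Rightarrow> bool) \<Rightarrow> nat poly \<Rightarrow> bool" where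
  "S2P_predicate P q \<longleftrightarrow> (\<exists>L \<in> S2P. S2P_defines P q L)"

text \<open>
  A marked witness \<open>(b, w)\<close> is coded as the string \<open>b # w\<close>, where the leading bit \<open>True\<close> stands
  for a first-player witness and \<open>False\<close> for a second-player witness.
\<close>

definition S2P_Search ::
  "(bits \<Rightarrow> bits \<Rightarrow> bits \<Rightarrow> bool) \<Rightarrow> nat poly \<Rightarrow> bits \<Rightarrow> bits \<Rightarrow> bool" where
  "S2P_Search P q x u \<longleftrightarrow>
     (\<exists>y. u = True # y \<and> length y = poly q (length x) \<and>
        (\<forall>z. length z = poly q (length x) \<longrightarrow> P x y z)) \<or>
     (\<exists>z. u = False # z \<and> length z = poly q (length x) \<and>
        (\<forall>y. length y = poly q (length x) \<longrightarrow> \<not> P x y z))"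

definition search_reduces :: "(bits \<Rightarrow> bits \<Rightarrow> bool) \<Rightarrow> (bits \<Rightarrow> bits \<Rightarrow> bool) \<Rightarrow> bool" where
  "search_reduces R S \<longleftrightarrow> (\<exists>f g. polytime_fun1 f \<and> polytime_fun2 g \<and>
     (\<forall>x w. S (f x) w \<longrightarrow> R x (g x w)))"

end

theory Submission
  imports Defs
begin

text \<open>
  For (1), the oracle accepts the pairs \<open>(x, u)\<close> for which \<open>u\<close> is refuted by some move of the
  opponent, so one query decides the search relation.

  For (2), the first player claims a solution \<open>w\<close> together with a transcript of the oracle
  computation deciding \<open>R x w\<close>: the oracle answers, with an NP witness for every positive one. The
  second player's move is a single string, which refutes the claim if it is an NP witness for some
  query that was answered negatively. A true transcript cannot be refuted, so the first player always
  wins and the language of the game is \<open>UNIV\<close>; conversely a transcript that survives all second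
  moves is true, whence \<open>R x w\<close>. Wrong answers may make the simulated machine diverge; therefore the
  transcript also serves as a clock: every iteration of a loop consumes one of its bits.
\<close>

section \<open>Timed runs\<close>

text \<open>The two kinds of wrong answers are handled differently. A false positive answer fails
  the check of its own witness, so only a false negative one needs an opponent. One short string is
  enough for that: up to the first wrong answer the simulation follows the true run, so this query
  has length polynomial in the input, and a witness for it fits into the second move. Of the
  derailed run afterwards it is only required that it halts in polynomial time and cannot erase the
  recorded refutation. The length of the moves has to be fixed in advance, although a longer claimed
  solution permits longer queries and so calls for longer witnesses. The circle is broken by
  treating overlong solutions as refuted from the start. Both moves have the same exact length;
  hence short data are coded self-delimitingly and padded. A verifier is called many times inside
  one program. Subroutines must therefore leave a completely known store, not only a correct
  register 0.\<close>

definition runs :: "bits set \<Rightarrow> com \<Rightarrow> store \<Rightarrow> store \<Rightarrow> nat \<Rightarrow> bool" where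
  "runs A c s s' T \<longleftrightarrow> (\<exists>t\<le>T. exec A c s t s')"

lemma runs_weaken:
  "runs A c s s1 T \<Longrightarrow> s1 = s' \<Longrightarrow> T \<le> T' \<Longrightarrow> runs A c s s' T'"
  unfolding runs_def by (auto intro: le_trans)

lemma runs_Skip: "runs A Skip s s 1"
  unfolding runs_def using exec.Skip by blast

lemma runs_Push: "runs A (Push r b) s (s(r := b # s r)) 1"
  unfolding runs_def using exec.Push by blast

lemma runs_Pop: "runs A (Pop r) s (s(r := tl (s r))) 1"
  unfolding runs_def using exec.Pop by blast

lemma runs_Query: "runs A (Query r) s (s(r := [s r \<in> A])) 1"
  unfolding runs_def using exec.Query by blast

lemma runs_Seq:
  "runs A c s s' T \<Longrightarrow> runs A d s' s'' T' \<Longrightarrow> runs A (Seq c d) s s'' (T + T')"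
  unfolding runs_def by (blast intro: exec.Seq add_mono)

lemma runs_IfTrue: "holds b s \<Longrightarrow> runs A c s s' T \<Longrightarrow> runs A (If b c d) s s' (Suc T)"
  unfolding runs_def by (blast intro: exec.IfTrue Suc_le_mono[THEN iffD2])

lemma runs_IfFalse: "\<not> holds b s \<Longrightarrow> runs A d s s' T \<Longrightarrow> runs A (If b c d) s s' (Suc T)"
  unfolding runs_def by (blast intro: exec.IfFalse Suc_le_mono[THEN iffD2])

lemma runs_If:
  "(holds b s \<Longrightarrow> runs A c s s' T) \<Longrightarrow> (\<not> holds b s \<Longrightarrow> runs A d s s' T) \<Longrightarrow>
    runs A (If b c d) s s' (Suc T)"
  by (cases "holds b s") (auto intro: runs_IfTrue runs_IfFalse)

lemma runs_WhileFalse: "\<not> holds b s \<Longrightarrow> runs A (While b c) s s 1"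
  unfolding runs_def using exec.WhileFalse by blast

lemma runs_WhileTrue:
  "holds b s \<Longrightarrow> runs A c s s' T \<Longrightarrow> runs A (While b c) s' s'' T' \<Longrightarrow>
    runs A (While b c) s s'' (Suc (T + T'))"
  unfolding runs_def by (blast intro: exec.WhileTrue add_mono Suc_le_mono[THEN iffD2])

lemma runs_deterministic: "runs A c s s' T \<Longrightarrow> runs A c s s'' T' \<Longrightarrow> s'' = s'"
  unfolding runs_def by (auto dest: exec_deterministic)

text \<open>The registers a program may write; those occurring only in tests are omitted, since
  tests change nothing.\<close>

fun registers :: "com \<Rightarrow> nat list" where
  "registers Skip = []"
| "registers (Push r b) = [r]"
| "registers (Pop r) = [r]"
| "registers (Query r) = [r]"
| "registers (Seq c d) = registers c @ registers d"
| "registers (If b c d) = registers c @ registers d"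
| "registers (While b c) = registers c"

lemma exec_frame: "exec A c s t s' \<Longrightarrow> r \<notin> set (registers c) \<Longrightarrow> s' r = s r"
  by (induction rule: exec.induct) auto

text \<open>A step pushes at most one bit, and an answered query leaves exactly one. Time bounds
  thus bound the registers too, in particular the length of queries.\<close>

lemma exec_length: "exec A c s t s' \<Longrightarrow> length (s' r) \<le> length (s r) + t"
  by (induction rule: exec.induct) auto

lemma exec_oracle_free: "exec A c s t s' \<Longrightarrow> oracle_free c \<Longrightarrow> exec B c s t s'"
  by (induction rule: exec.induct) (auto intro: exec.intros exec.intros[simplified])

section \<open>Renaming of registers\<close>

fun rename_test :: "(nat \<Rightarrow> nat) \<Rightarrow> test \<Rightarrow> test" where
  "rename_test f (NonEmpty r) = NonEmpty (f r)"
| "rename_test f (TopOne r) = TopOne (f r)"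

fun rename :: "(nat \<Rightarrow> nat) \<Rightarrow> com \<Rightarrow> com" where
  "rename f Skip = Skip"
| "rename f (Push r b) = Push (f r) b"
| "rename f (Pop r) = Pop (f r)"
| "rename f (Query r) = Query (f r)"
| "rename f (Seq c d) = Seq (rename f c) (rename f d)"
| "rename f (If b c d) = If (rename_test f b) (rename f c) (rename f d)"
| "rename f (While b c) = While (rename_test f b) (rename f c)"

lemma oracle_free_rename [simp]: "oracle_free (rename f c) = oracle_free c"
  by (induction c) auto

lemma holds_rename_test [simp]: "holds (rename_test f b) s = holds b (s \<circ> f)"
  by (cases b) auto

text \<open>Injectivity keeps distinct registers apart, so updates commute with composing the store
  with \<open>f\<close>. A program can thereby run on freely chosen registers of a larger
  store.\<close>

lemma exec_rename:
  assumes "exec A c s t s'" "inj f" "\<sigma> \<circ> f = s"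
  shows "\<exists>\<sigma>'. exec A (rename f c) \<sigma> t \<sigma>' \<and> \<sigma>' \<circ> f = s' \<and> (\<forall>r. r \<notin> range f \<longrightarrow> \<sigma>' r = \<sigma> r)"
  using assms
proof (induction arbitrary: \<sigma> rule: exec.induct)
  case (Skip s)
  then show ?case by (auto intro!: exI[of _ \<sigma>] exec.Skip[simplified])
next
  case (Push r b s)
  have "exec A (rename f (Push r b)) \<sigma> 1 (\<sigma>(f r := b # \<sigma> (f r)))" by (simp add: exec.Push[simplified])
  moreover have "\<sigma>(f r := b # \<sigma> (f r)) \<circ> f = s(r := b # s r)"
    using Push by (auto simp: fun_eq_iff inj_eq)
  ultimately show ?case by (intro exI conjI allI impI) (assumption, assumption, auto)
next
  case (Pop r s)
  have "exec A (rename f (Pop r)) \<sigma> 1 (\<sigma>(f r := tl (\<sigma> (f r))))" by (simp add: exec.Pop[simplified])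
  moreover have "\<sigma>(f r := tl (\<sigma> (f r))) \<circ> f = s(r := tl (s r))"
    using Pop by (auto simp: fun_eq_iff inj_eq)
  ultimately show ?case by (intro exI conjI allI impI) (assumption, assumption, auto)
next
  case (Query r s)
  have "exec A (rename f (Query r)) \<sigma> 1 (\<sigma>(f r := [\<sigma> (f r) \<in> A]))" by (simp add: exec.Query[simplified])
  moreover have "\<sigma>(f r := [\<sigma> (f r) \<in> A]) \<circ> f = s(r := [s r \<in> A])"
    using Query by (auto simp: fun_eq_iff inj_eq)
  ultimately show ?case by (intro exI conjI allI impI) (assumption, assumption, auto)
next
  case (Seq c s t s' d t' s'')
  then show ?case by (fastforce intro: exec.Seq)
next
  case (IfTrue b s c t s' d)
  then obtain \<sigma>' where "exec A (rename f c) \<sigma> t \<sigma>'" "\<sigma>' \<circ> f = s'"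
    "\<forall>r. r \<notin> range f \<longrightarrow> \<sigma>' r = \<sigma> r"
    by blast
  then show ?case using IfTrue by (auto intro!: exI[of _ \<sigma>'] exec.IfTrue simp: comp_def)
next
  case (IfFalse b s d t s' c)
  then obtain \<sigma>' where "exec A (rename f d) \<sigma> t \<sigma>'" "\<sigma>' \<circ> f = s'"
    "\<forall>r. r \<notin> range f \<longrightarrow> \<sigma>' r = \<sigma> r"
    by blast
  then show ?case using IfFalse by (auto intro!: exI[of _ \<sigma>'] exec.IfFalse simp: comp_def)
next
  case (WhileFalse b s c)
  then show ?case by (auto intro!: exI[of _ \<sigma>] exec.WhileFalse[simplified] simp: comp_def)
next
  case (WhileTrue b s c t s' t' s'')
  then obtain \<sigma>' where 1: "exec A (rename f c) \<sigma> t \<sigma>'" "\<sigma>' \<circ> f = s'"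
    "\<forall>r. r \<notin> range f \<longrightarrow> \<sigma>' r = \<sigma> r"
    by blast
  then obtain \<sigma>'' where "exec A (rename f (While b c)) \<sigma>' t' \<sigma>''" "\<sigma>'' \<circ> f = s''"
    "\<forall>r. r \<notin> range f \<longrightarrow> \<sigma>'' r = \<sigma>' r"
    using WhileTrue by blast
  then show ?case using WhileTrue 1 by (auto intro!: exI[of _ \<sigma>''] exec.WhileTrue simp: comp_def)
qed

lemma runs_rename:
  assumes "runs A c (\<sigma> \<circ> f) s' T" "inj f" "\<sigma>' \<circ> f = s'" "\<And>r. r \<notin> range f \<Longrightarrow> \<sigma>' r = \<sigma> r"
  shows "runs A (rename f c) \<sigma> \<sigma>' T"
proof -
  obtain t where t: "t \<le> T" "exec A c (\<sigma> \<circ> f) t s'"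
    using assms(1) by (auto simp: runs_def)
  obtain \<sigma>'' where *: "exec A (rename f c) \<sigma> t \<sigma>''" "\<sigma>'' \<circ> f = s'" "\<forall>r. r \<notin> range f \<longrightarrow> \<sigma>'' r = \<sigma> r"
    using exec_rename[OF t(2) assms(2) refl] by auto
  have "\<sigma>'' r = \<sigma>' r" for r
  proof (cases "r \<in> range f")
    case True
    then obtain i where "r = f i" by auto
    then show ?thesis using *(2) assms(3) by (metis comp_apply)
  qed (use * assms(4) in simp)
  then show ?thesis using * t by (metis ext runs_def)
qed

section \<open>Polynomial bounds\<close>

lemma poly_nat_mono: "m \<le> n \<Longrightarrow> poly p m \<le> poly p (n :: nat)"
  by (induction p) (auto intro!: add_mono mult_mono)

text \<open>Being dominated by a polynomial, rather than being one, survives all combinations of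
  time bounds below, so explicit polynomials need not be computed.\<close>

definition poly_bounded :: "(nat \<Rightarrow> nat) \<Rightarrow> bool" where
  "poly_bounded T \<longleftrightarrow> (\<exists>p. \<forall>n. T n \<le> poly p n)"

lemma poly_bounded_const [intro]: "poly_bounded (\<lambda>n. k)"
  unfolding poly_bounded_def by (rule exI[of _ "[:k:]"]) simp

lemma poly_bounded_id [intro]: "poly_bounded (\<lambda>n. n)"
  unfolding poly_bounded_def by (rule exI[of _ "[:0, 1:]"]) simp

lemma poly_bounded_add [intro]:
  assumes "poly_bounded S" "poly_bounded T"
  shows "poly_bounded (\<lambda>n. S n + T n)"
proof -
  obtain p q where "\<forall>n. S n \<le> poly p n" "\<forall>n. T n \<le> poly q n"
    using assms unfolding poly_bounded_def by auto
  then show ?thesis unfolding poly_bounded_def by (intro exI[of _ "p + q"]) (simp add: add_mono)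
qed

lemma poly_bounded_Suc [intro]: "poly_bounded T \<Longrightarrow> poly_bounded (\<lambda>n. Suc (T n))"
  using poly_bounded_add[OF _ poly_bounded_const, of T 1] by simp

lemma poly_bounded_mult [intro]:
  assumes "poly_bounded S" "poly_bounded T"
  shows "poly_bounded (\<lambda>n. S n * T n)"
proof -
  obtain p q where "\<forall>n. S n \<le> poly p n" "\<forall>n. T n \<le> poly q n"
    using assms unfolding poly_bounded_def by auto
  then show ?thesis unfolding poly_bounded_def by (intro exI[of _ "p * q"]) (simp add: mult_mono)
qed

lemma poly_bounded_poly [intro]:
  assumes "poly_bounded T"
  shows "poly_bounded (\<lambda>n. poly q (T n))"
proof -
  obtain p where "\<forall>n. T n \<le> poly p n"
    using assms unfolding poly_bounded_def by auto
  then show ?thesis unfolding poly_bounded_def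
    by (intro exI[of _ "q \<circ>\<^sub>p p"]) (simp add: poly_pcompose poly_nat_mono)
qed

section \<open>Basic programs\<close>

definition move_bit :: "nat \<Rightarrow> nat \<Rightarrow> com" where
  "move_bit r q = If (TopOne r) (Seq (Pop r) (Push q True)) (Seq (Pop r) (Push q False))"

definition move :: "nat \<Rightarrow> nat \<Rightarrow> com" where
  "move r q = While (NonEmpty r) (move_bit r q)"

definition copy_back :: "nat \<Rightarrow> nat \<Rightarrow> nat \<Rightarrow> com" where
  "copy_back u r q = While (NonEmpty u)
    (If (TopOne u) (Seq (Pop u) (Seq (Push r True) (Push q True)))
                   (Seq (Pop u) (Seq (Push r False) (Push q False))))"

text \<open>Emptying one stack onto another reverses it; the way back restores the order in both
  targets.\<close>

definition copy :: "nat \<Rightarrow> nat \<Rightarrow> nat \<Rightarrow> com" where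
  "copy r q u = Seq (move r u) (copy_back u r q)"

definition clear :: "nat \<Rightarrow> com" where
  "clear r = While (NonEmpty r) (Pop r)"

fun clear_all :: "nat list \<Rightarrow> com" where
  "clear_all [] = Skip"
| "clear_all (r # rs) = Seq (clear r) (clear_all rs)"

fun push_ones :: "nat \<Rightarrow> nat \<Rightarrow> com" where
  "push_ones r 0 = Skip"
| "push_ones r (Suc k) = Seq (Push r True) (push_ones r k)"

lemma oracle_free_basic [simp]:
  "oracle_free (move_bit r q)" "oracle_free (move r q)" "oracle_free (copy r q u)"
  "oracle_free (clear r)" "oracle_free (clear_all rs)" "oracle_free (push_ones r k)"
  by (induction rs) (auto simp: move_bit_def move_def copy_def copy_back_def clear_def,
    induction k, auto)

lemma runs_move_bit:
  assumes "r \<noteq> q" "s r = b # w"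
  shows "runs A (move_bit r q) s (s(r := w, q := b # s q)) 3"
proof -
  have "runs A (move_bit r q) s (s(r := w, q := b # s q)) (Suc 2)"
    unfolding move_bit_def
    by (rule runs_If; rule runs_weaken[OF runs_Seq[OF runs_Pop runs_Push]]) (use assms in auto)
  then show ?thesis by (rule runs_weaken) auto
qed

lemma runs_move:
  assumes "r \<noteq> q"
  shows "runs A (move r q) s (s(r := [], q := rev (s r) @ s q)) (4 * length (s r) + 1)"
proof (induction "s r" arbitrary: s)
  case Nil
  show ?case unfolding move_def
    by (rule runs_weaken[OF runs_WhileFalse]) (use Nil in auto)
next
  case (Cons b w)
  let ?s = "s(r := w, q := b # s q)"
  have 2: "runs A (move r q) ?s (?s(r := [], q := rev (?s r) @ ?s q)) (4 * length (?s r) + 1)"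
    by (rule Cons(1)) (use assms in simp)
  show ?case unfolding move_def
    by (rule runs_weaken[OF runs_WhileTrue[OF _ runs_move_bit[OF assms, of s b w] 2[unfolded move_def]]])
       (use assms Cons(2)[symmetric] in auto)
qed

lemma runs_copy_back:
  assumes "distinct [u, r, q]"
  shows "runs A (copy_back u r q) s (s(u := [], r := rev (s u) @ s r, q := rev (s u) @ s q))
    (5 * length (s u) + 1)"
proof (induction "s u" arbitrary: s)
  case Nil
  show ?case unfolding copy_back_def
    by (rule runs_weaken[OF runs_WhileFalse]) (use Nil in auto)
next
  case (Cons b w)
  let ?s = "s(u := w, r := b # s r, q := b # s q)"
  let ?c = "If (TopOne u) (Seq (Pop u) (Seq (Push r True) (Push q True)))
                   (Seq (Pop u) (Seq (Push r False) (Push q False)))"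
  have 1: "runs A ?c s ?s 4"
    by (rule runs_weaken[OF runs_If[where T = 3] refl];
        (rule runs_weaken[OF runs_Seq[OF runs_Pop runs_Seq[OF runs_Push runs_Push]]])?)
       (use assms Cons(2)[symmetric] in auto)
  have 2: "runs A (copy_back u r q) ?s (?s(u := [], r := rev (?s u) @ ?s r, q := rev (?s u) @ ?s q))
    (5 * length (?s u) + 1)"
    by (rule Cons(1)) (use assms in simp)
  show ?case unfolding copy_back_def
    by (rule runs_weaken[OF runs_WhileTrue[OF _ 1 2[unfolded copy_back_def]]])
       (use assms Cons(2)[symmetric] in auto)
qed

lemma runs_copy:
  assumes "distinct [u, r, q]" "s u = []"
  shows "runs A (copy r q u) s (s(q := s r @ s q)) (9 * length (s r) + 2)"
proof -
  have ne: "r \<noteq> u" using assms by auto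
  show ?thesis unfolding copy_def
    by (rule runs_weaken[OF runs_Seq[OF runs_move[OF ne] runs_copy_back[OF assms(1)]]])
       (use assms in auto)
qed

lemma runs_clear: "runs A (clear r) s (s(r := [])) (2 * length (s r) + 1)"
proof (induction "s r" arbitrary: s)
  case Nil
  show ?case unfolding clear_def
    by (rule runs_weaken[OF runs_WhileFalse]) (use Nil in auto)
next
  case (Cons b w)
  have 2: "runs A (clear r) (s(r := tl (s r))) ((s(r := tl (s r)))(r := [])) (2 * length ((s(r := tl (s r))) r) + 1)"
    by (rule Cons(1)) (use Cons(2)[symmetric] in simp)
  show ?case unfolding clear_def
    by (rule runs_weaken[OF runs_WhileTrue[OF _ runs_Pop 2[unfolded clear_def]]])
       (use Cons(2)[symmetric] in auto)
qed

lemma runs_clear_all: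
  assumes "\<And>r. length (s r) \<le> m"
  shows "runs A (clear_all rs) s (\<lambda>r. if r \<in> set rs then [] else s r) (length rs * (2 * m + 1) + 1)"
  using assms
proof (induction rs arbitrary: s)
  case Nil
  then show ?case by (simp add: runs_Skip[simplified])
next
  case (Cons r rs)
  have "runs A (clear_all rs) (s(r := [])) (\<lambda>i. if i \<in> set rs then [] else (s(r := [])) i) (length rs * (2 * m + 1) + 1)"
    by (rule Cons(1)) (use Cons(2) in auto)
  then have "runs A (clear_all (r # rs)) s (\<lambda>i. if i \<in> set rs then [] else (s(r := [])) i)
     (2 * length (s r) + 1 + (length rs * (2 * m + 1) + 1))"
    unfolding clear_all.simps by (rule runs_Seq[OF runs_clear])
  then show ?case
    by (rule runs_weaken) (use Cons(2)[of r] in \<open>auto simp: algebra_simps\<close>)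
qed

lemma runs_push_ones: "runs A (push_ones r k) s (s(r := replicate k True @ s r)) (k + 1)"
proof (induction k arbitrary: s)
  case 0
  then show ?case unfolding push_ones.simps by (rule runs_weaken[OF runs_Skip]) auto
next
  case (Suc k)
  show ?case unfolding push_ones.simps
    by (rule runs_weaken[OF runs_Seq[OF runs_Push Suc]])
       (auto simp: replicate_app_Cons_same)
qed

section \<open>Polynomial-time functions as reusable subroutines\<close>

lemma length_input_le: "length (input xs r) \<le> sum_list (map length xs)"
  by (auto simp: input_def member_le_sum_list)

text \<open>Garbage can lie only in registers that the program writes or that held arguments, and it
  is no longer than the input plus the running time; so it can be cleared in polynomial time.
  Oracle-freeness makes the oracle arbitrary.\<close>

lemma polytime_clean:
  assumes "polytime n F"
  obtains c p where "oracle_free c"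
    "\<And>xs A. length xs = n \<Longrightarrow> runs A c (input xs) (input [F xs]) (poly p (sum_list (map length xs)))"
proof -
  obtain c p where c: "oracle_free c"
    and p: "\<And>xs. length xs = n \<Longrightarrow> \<exists>t s. exec {} c (input xs) t s \<and> s 0 = F xs
      \<and> t \<le> poly p (sum_list (map length xs))"
    using assms unfolding polytime_def computes_polytime_def by blast
  define rs where "rs = filter (\<lambda>r. r \<noteq> 0) (registers c @ [0..<n])"
  define T where "T k = poly p k + (length rs * (2 * (k + poly p k) + 1) + 1)" for k
  have "poly_bounded T" unfolding T_def by (intro poly_bounded_add poly_bounded_mult poly_bounded_const poly_bounded_id poly_bounded_poly)
  then obtain q where q: "\<And>k. T k \<le> poly q k" unfolding poly_bounded_def by auto
  have "runs A (Seq c (clear_all rs)) (input xs) (input [F xs]) (poly q (sum_list (map length xs)))"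
    if xs: "length xs = n" for xs A
  proof -
    let ?N = "sum_list (map length xs)"
    obtain t s where s: "exec {} c (input xs) t s" "s 0 = F xs" "t \<le> poly p ?N"
      using p[OF xs] by blast
    have 1: "runs A c (input xs) s (poly p ?N)"
      using exec_oracle_free[OF s(1) c] s(3) by (auto simp: runs_def)
    have 2: "length (s r) \<le> ?N + poly p ?N" for r
      using exec_length[OF s(1), of r] length_input_le[of xs r] s(3) by linarith
    have "(\<lambda>r. if r \<in> set rs then [] else s r) = input [F xs]"
    proof
      fix r
      show "(if r \<in> set rs then [] else s r) = input [F xs] r"
        using exec_frame[OF s(1), of r] s(2) xs by (auto simp: rs_def input_def)
    qed
    then show ?thesis
      by (intro runs_weaken[OF runs_Seq[OF 1 runs_clear_all[OF 2]]])
         (use q[of ?N] in \<open>auto simp: T_def\<close>)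
  qed
  moreover have "oracle_free (Seq c (clear_all rs))" using c by simp
  ultimately show ?thesis using that by blast
qed

lemma computes_polytimeI:
  assumes "poly_bounded T"
    and "\<And>xs. length xs = n \<Longrightarrow> \<exists>s. runs A c (input xs) s (T (sum_list (map length xs))) \<and> s 0 = F xs"
  shows "computes_polytime A c n F"
proof -
  obtain p where "\<And>k. T k \<le> poly p k" using assms(1) unfolding poly_bounded_def by auto
  then show ?thesis using assms(2) unfolding computes_polytime_def runs_def by (meson le_trans)
qed

lemma polytimeI:
  assumes "oracle_free c" "poly_bounded T"
    and "\<And>xs. length xs = n \<Longrightarrow> \<exists>s. runs {} c (input xs) s (T (sum_list (map length xs))) \<and> s 0 = F xs"
  shows "polytime n F"
  using assms computes_polytimeI unfolding polytime_def by blast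

section \<open>Unary arithmetic\<close>

text \<open>The string in \<open>x\<close> acts only as a counter but must survive as an argument,
  so its bits are saved in \<open>t\<close>.\<close>

definition add_times :: "nat \<Rightarrow> nat \<Rightarrow> nat \<Rightarrow> nat \<Rightarrow> nat \<Rightarrow> com" where
  "add_times x a b t u = While (NonEmpty x) (Seq (move_bit x t) (copy a b u))"

definition multiply :: "nat \<Rightarrow> nat \<Rightarrow> nat \<Rightarrow> nat \<Rightarrow> nat \<Rightarrow> com" where
  "multiply x a b t u =
    Seq (add_times x a b t u) (Seq (move t x) (Seq (clear a) (move b a)))"

lemma runs_add_times:
  assumes "distinct [x, a, b, t, u]" "s u = []" "s a = replicate m True"
  shows "runs A (add_times x a b t u) s
    (s(x := [], t := rev (s x) @ s t, b := replicate (length (s x) * m) True @ s b))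
    (length (s x) * (9 * m + 6) + 1)"
  using assms(2,3)
proof (induction "s x" arbitrary: s)
  case Nil
  show ?case unfolding add_times_def
    by (rule runs_weaken[OF runs_WhileFalse]) (use Nil in auto)
next
  case (Cons d w)
  let ?s1 = "s(x := w, t := d # s t)"
  let ?s = "?s1(b := replicate m True @ s b)"
  have xt: "x \<noteq> t" and d: "distinct [u, a, b]" using assms(1) by auto
  have 1: "runs A (move_bit x t) s ?s1 3"
    by (rule runs_move_bit[OF xt]) (simp add: Cons(2)[symmetric])
  have 2: "runs A (copy a b u) ?s1 ?s (9 * m + 2)"
    by (rule runs_weaken[OF runs_copy[OF d]]) (use assms(1) Cons(3,4) in auto)
  have 3: "runs A (add_times x a b t u) ?s
    (?s(x := [], t := rev (?s x) @ ?s t, b := replicate (length (?s x) * m) True @ ?s b))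
    (length (?s x) * (9 * m + 6) + 1)"
    by (rule Cons(1)) (use assms(1) Cons(3,4) in auto)
  have *: "replicate (length w * m) True @ replicate m True @ s b
      = replicate (m + length w * m) True @ s b"
    by (metis append_assoc replicate_add add.commute)
  show ?case unfolding add_times_def
    by (rule runs_weaken[OF runs_WhileTrue[OF _ runs_Seq[OF 1 2] 3[unfolded add_times_def]]])
       (use assms(1) Cons(2)[symmetric] * in auto)
qed

lemma runs_multiply:
  assumes "distinct [x, a, b, t, u]" "s b = []" "s t = []" "s u = []" "s a = replicate m True"
  shows "runs A (multiply x a b t u) s (s(a := replicate (length (s x) * m) True))
    (length (s x) * (9 * m + 6) + 4 * length (s x) + 2 * m + 4 * (length (s x) * m) + 4)"
proof -
  have ne: "t \<noteq> x" "b \<noteq> a" using assms by auto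
  show ?thesis unfolding multiply_def
    by (rule runs_weaken[OF runs_Seq[OF runs_add_times[OF assms(1,4,5)]
          runs_Seq[OF runs_move[OF ne(1)] runs_Seq[OF runs_clear runs_move[OF ne(2)]]]]])
       (use assms in auto)
qed

text \<open>Horner's scheme: the value of \<open>pCons k p\<close> at n is \<open>k\<close> plus n
  times the value of \<open>p\<close>, so each coefficient costs one multiplication and
  \<open>k\<close> pushes.\<close>

lemma polynomial_program:
  assumes "distinct [x, a, b, t, u]"
  shows "\<exists>c T. oracle_free c \<and> poly_bounded T \<and> (\<forall>A s. s a = [] \<longrightarrow> s b = [] \<longrightarrow> s t = [] \<longrightarrow> s u = [] \<longrightarrow>
    runs A c s (s(a := replicate (poly p (length (s x))) True)) (T (length (s x))))"
proof (induction p)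
  case 0
  show ?case
    by (rule exI[of _ Skip], rule exI[of _ "\<lambda>n. 1"])
       (auto intro!: runs_weaken[OF runs_Skip])
next
  case (pCons k p)
  then obtain c T where c: "oracle_free c" "poly_bounded T" and
    run: "\<And>A s. s a = [] \<Longrightarrow> s b = [] \<Longrightarrow> s t = [] \<Longrightarrow> s u = [] \<Longrightarrow>
      runs A c s (s(a := replicate (poly p (length (s x))) True)) (T (length (s x)))"
    by blast
  define c' where "c' = Seq c (Seq (multiply x a b t u) (push_ones a k))"
  define T' where "T' n = T n + ((n * (9 * poly p n + 6) + 4 * n + 2 * poly p n
    + 4 * (n * poly p n) + 4) + (k + 1))" for n
  have "oracle_free c'"
    using c unfolding c'_def multiply_def add_times_def by simp
  moreover have "poly_bounded T'" unfolding T'_def using c(2)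
    by (intro poly_bounded_add poly_bounded_mult poly_bounded_const poly_bounded_id poly_bounded_poly)
  moreover have "runs A c' s (s(a := replicate (poly (pCons k p) (length (s x))) True)) (T' (length (s x)))"
    if "s a = []" "s b = []" "s t = []" "s u = []" for A s
  proof -
    let ?n = "length (s x)" 
    let ?s = "s(a := replicate (poly p ?n) True)"
    have 1: "runs A (multiply x a b t u) ?s (?s(a := replicate (length (?s x) * poly p ?n) True))
      (?n * (9 * poly p ?n + 6) + 4 * ?n + 2 * poly p ?n + 4 * (?n * poly p ?n) + 4)"
      by (rule runs_weaken[OF runs_multiply[OF assms, of _ "poly p ?n"] refl]) (use that assms in auto)
    show ?thesis unfolding c'_def
      by (rule runs_weaken[OF runs_Seq[OF run[OF that] runs_Seq[OF 1 runs_push_ones]]])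
         (use assms in \<open>auto simp: T'_def replicate_add\<close>)
  qed
  ultimately show ?case by blast
qed

section \<open>Comparing a length with the value of a polynomial\<close>

definition match :: "nat \<Rightarrow> nat \<Rightarrow> nat \<Rightarrow> com" where
  "match a k f = While (NonEmpty a) (Seq (Pop a) (If (NonEmpty k) (Pop k) (Push f True)))"

lemma runs_match:
  assumes "distinct [a, k, f]" "s k = replicate m True"
  shows "runs A (match a k f) s (s(a := [], k := replicate (m - length (s a)) True,
    f := replicate (length (s a) - m) True @ s f)) (4 * length (s a) + 1)"
  using assms(2)
proof (induction "s a" arbitrary: s m)
  case Nil
  show ?case unfolding match_def
    by (rule runs_weaken[OF runs_WhileFalse]) (use Nil in auto)
next
  case (Cons d w)
  \<comment> \<open>One formula for both branches: if \<open>m\<close> is 0, then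
    \<open>1 - m\<close> adds one mark to \<open>f\<close>; otherwise one mark is taken off
    \<open>k\<close>.\<close>
  let ?s = "s(a := w, k := replicate (m - 1) True, f := replicate (1 - m) True @ s f)"
  have 1: "runs A (If (NonEmpty k) (Pop k) (Push f True)) (s(a := tl (s a))) ?s (Suc 1)"
  proof (cases m)
    case 0
    then show ?thesis
      by (intro runs_weaken[OF runs_IfFalse[OF _ runs_Push]])
         (use assms(1) Cons(2)[symmetric] Cons(3) in \<open>auto simp: fun_eq_iff\<close>)
  next
    case (Suc n)
    then show ?thesis
      by (intro runs_weaken[OF runs_IfTrue[OF _ runs_Pop]])
         (use assms(1) Cons(2)[symmetric] Cons(3) in \<open>auto simp: fun_eq_iff\<close>)
  qed
  have 2: "runs A (match a k f) ?s (?s(a := [], k := replicate (m - 1 - length (?s a)) True,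
    f := replicate (length (?s a) - (m - 1)) True @ ?s f)) (4 * length (?s a) + 1)"
    by (rule Cons(1)) (use assms(1) in auto)
  have *: "replicate (length w - (m - Suc 0)) True @ replicate (Suc 0 - m) True @ s f
      = replicate (Suc (length w) - m) True @ s f"
    by (cases m) (auto simp: replicate_app_Cons_same)
  show ?case unfolding match_def
    by (rule runs_weaken[OF runs_WhileTrue[OF _ runs_Seq[OF runs_Pop 1] 2[unfolded match_def]]])
       (use assms(1) Cons(2)[symmetric] * in \<open>auto simp: fun_eq_iff\<close>)
qed

text \<open>Truncated subtraction in both directions tells the three cases apart. For equal lengths
  both differences vanish and the store is unchanged, ready for a cleaned subroutine.\<close>

lemma length_comparison_program:
  assumes "distinct [x, b, k, f, t, u, v]"
  shows "\<exists>c T. oracle_free c \<and> poly_bounded T \<and> (\<forall>A s. s k = [] \<longrightarrow> s t = [] \<longrightarrow> s u = [] \<longrightarrow> s v = [] \<longrightarrow>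
    runs A c s (s(k := replicate (poly p (length (s x)) - length (s b)) True,
        f := replicate (length (s b) - poly p (length (s x))) True @ s f))
      (T (length (s x) + length (s b))))"
proof -
  have "distinct [x, k, t, u, v]" using assms by auto
  from polynomial_program[OF this, of p] obtain c T where c: "oracle_free c" "poly_bounded T" and
    run: "\<And>A s. s k = [] \<Longrightarrow> s t = [] \<Longrightarrow> s u = [] \<Longrightarrow> s v = [] \<Longrightarrow>
      runs A c s (s(k := replicate (poly p (length (s x))) True)) (T (length (s x)))"
    by blast
  obtain q where q: "\<And>n. T n \<le> poly q n" using c(2) unfolding poly_bounded_def by auto
  have d: "distinct [u, b, t]" "distinct [t, k, f]" using assms by auto
  define T' where "T' n = poly q n + ((9 * n + 2) + (4 * n + 1))" for n
  have "poly_bounded T'" unfolding T'_def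
    by (intro poly_bounded_add poly_bounded_mult poly_bounded_const poly_bounded_id poly_bounded_poly)
  moreover have "oracle_free (Seq c (Seq (copy b t u) (match t k f)))"
    using c by (simp add: match_def)
  moreover have "runs A (Seq c (Seq (copy b t u) (match t k f))) s
      (s(k := replicate (poly p (length (s x)) - length (s b)) True,
        f := replicate (length (s b) - poly p (length (s x))) True @ s f))
      (T' (length (s x) + length (s b)))"
    if *: "s k = []" "s t = []" "s u = []" "s v = []" for A s
  proof -
    let ?n = "length (s x)"
    let ?s1 = "s(k := replicate (poly p ?n) True)"
    let ?s2 = "?s1(t := s b)"
    have 1: "runs A c s ?s1 (poly q (length (s x) + length (s b)))"
      by (rule runs_weaken[OF run[OF *] refl]) (meson q poly_nat_mono le_add1 le_trans)
    have 2: "runs A (copy b t u) ?s1 ?s2 (9 * length (s b) + 2)"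
      by (rule runs_weaken[OF runs_copy[OF d(1)]]) (use * assms in auto)
    have 3: "runs A (match t k f) ?s2 (?s2(t := [], k := replicate (poly p ?n - length (?s2 t)) True,
        f := replicate (length (?s2 t) - poly p ?n) True @ ?s2 f)) (4 * length (?s2 t) + 1)"
      by (rule runs_match[OF d(2)]) (use assms in auto)
    show ?thesis
      by (rule runs_weaken[OF runs_Seq[OF 1 runs_Seq[OF 2 3]]])
         (use * assms in \<open>auto simp: T'_def fun_eq_iff\<close>)
  qed
  ultimately show ?thesis by blast
qed

section \<open>Self-delimiting encoding\<close>

text \<open>Each bit is preceded by \<open>True\<close>; in \<open>pair\<close>, a
  \<open>False\<close> ends the code. The bits appear in reverse because moving a stack bit by bit
  produces that order, and decoding onto a stack reverses them again.\<close>

fun encode :: "bits \<Rightarrow> bits \<Rightarrow> bits" where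
  "encode [] e = e"
| "encode (b # w) e = encode w (True # b # e)"

text \<open>The first argument accumulates decoded bits. Ill-formed strings need values too, since
  moves are arbitrary; a lone \<open>True\<close> yields an extra \<open>False\<close> because
  \<open>move_bit\<close> on an empty stack pushes \<open>False\<close>.\<close>

fun decode :: "bits \<Rightarrow> bits \<Rightarrow> bits \<times> bits" where
  "decode w (True # b # e) = decode (b # w) e"
| "decode w [True] = (False # w, [])"
| "decode w (False # e) = (w, e)"
| "decode w [] = (w, [])"

abbreviation pair :: "bits \<Rightarrow> bits \<Rightarrow> bits" where
  "pair w e \<equiv> encode w (False # e)"

lemma decode_encode: "decode v (encode w e) = decode (w @ v) e"
  by (induction w e rule: encode.induct) auto

lemma decode_pair [simp]: "decode [] (pair w e) = (w, e)"
  by (simp add: decode_encode)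

lemma length_encode [simp]: "length (encode w e) = 2 * length w + length e"
  by (induction w e rule: encode.induct) auto

lemma encode_append: "encode w e @ f = encode w (e @ f)"
  by (induction w e rule: encode.induct) auto

lemma length_decode: "length (fst (decode w e)) + length (snd (decode w e)) \<le> length w + length e"
  by (induction w e rule: decode.induct) auto

definition encode_program :: "nat \<Rightarrow> nat \<Rightarrow> com" where
  "encode_program r q = While (NonEmpty r) (Seq (move_bit r q) (Push q True))"

definition decode_program :: "nat \<Rightarrow> nat \<Rightarrow> com" where
  "decode_program r q = Seq (While (TopOne r) (Seq (Pop r) (move_bit r q))) (Pop r)"

lemma oracle_free_encode [simp]:
  "oracle_free (encode_program r q)" "oracle_free (decode_program r q)"
  by (auto simp: encode_program_def decode_program_def)

lemma runs_encode:
  assumes "r \<noteq> q"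
  shows "runs A (encode_program r q) s (s(r := [], q := encode (s r) (s q))) (5 * length (s r) + 1)"
proof (induction "s r" arbitrary: s)
  case Nil
  show ?case unfolding encode_program_def
    by (rule runs_weaken[OF runs_WhileFalse]) (use Nil(1)[symmetric] in auto)
next
  case (Cons d w)
  let ?s = "s(r := w, q := True # d # s q)"
  have 1: "runs A (Seq (move_bit r q) (Push q True)) s ?s (3 + 1)"
    by (rule runs_weaken[OF runs_Seq[OF runs_move_bit[OF assms, of s d w] runs_Push]])
       (use Cons(2) in auto)
  have 2: "runs A (encode_program r q) ?s (?s(r := [], q := encode (?s r) (?s q))) (5 * length (?s r) + 1)"
    by (rule Cons(1)) (use assms in auto)
  show ?case unfolding encode_program_def
    by (rule runs_weaken[OF runs_WhileTrue[OF _ 1 2[unfolded encode_program_def]]])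
       (use assms Cons(2)[symmetric] in auto)
qed

lemma runs_decode:
  assumes "r \<noteq> q"
  shows "runs A (decode_program r q) s
    (s(r := snd (decode (s q) (s r)), q := fst (decode (s q) (s r)))) (5 * length (s r) + 7)"
proof -
  let ?loop = "While (TopOne r) (Seq (Pop r) (move_bit r q))"
  have "\<exists>s1. runs A ?loop s s1 (5 * length (s r) + 6) \<and>
    s1(r := tl (s1 r)) = s(r := snd (decode (s q) (s r)), q := fst (decode (s q) (s r)))"
  proof (induction "s q" "s r" arbitrary: s rule: decode.induct)
    case (1 b e)
    let ?s = "s(r := e, q := b # s q)"
    obtain s1 where s1: "runs A ?loop ?s s1 (5 * length (?s r) + 6)"
       "s1(r := tl (s1 r)) = ?s(r := snd (decode (?s q) (?s r)), q := fst (decode (?s q) (?s r)))"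
      using 1(1)[of ?s] assms by auto
    have "runs A (Seq (Pop r) (move_bit r q)) s ?s 4"
      by (rule runs_weaken[OF runs_Seq[OF runs_Pop runs_move_bit[OF assms, of _ b e]]])
         (use assms 1(2)[symmetric] in auto)
    then have "runs A ?loop s s1 (5 * length (s r) + 6)"
      by (intro runs_weaken[OF runs_WhileTrue[OF _ _ s1(1)] refl]) (use 1(2)[symmetric] assms in auto)
    moreover have "s1(r := tl (s1 r)) = s(r := snd (decode (s q) (s r)), q := fst (decode (s q) (s r)))"
      using s1(2) 1(2)[symmetric] assms by (simp add: fun_upd_twist fun_eq_iff)
    ultimately show ?case by blast
  next
    case 2
    let ?s = "s(r := [], q := False # s q)"
    have "runs A (move_bit r q) (s(r := [])) ?s 3" unfolding move_bit_def
      by (rule runs_weaken[OF runs_IfFalse[OF _ runs_Seq[OF runs_Pop runs_Push]]])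
         (use assms in auto)
    then have "runs A (Seq (Pop r) (move_bit r q)) s ?s (1 + 3)"
      by (intro runs_weaken[OF runs_Seq[OF runs_Pop]]) (auto simp: 2[symmetric])
    then have "runs A ?loop s ?s (Suc (1 + 3 + 1))"
      by (rule runs_WhileTrue[rotated, OF _ runs_WhileFalse]) (use 2[symmetric] assms in auto)
    then show ?case using 2[symmetric] assms by (auto intro!: exI[of _ ?s] elim!: runs_weaken)
  next
    case (3 e)
    then show ?case using assms
      by (intro exI[of _ s] conjI runs_weaken[OF runs_WhileFalse])
        (auto simp: 3(1)[symmetric])
  next
    case 4
    then show ?case using assms
      by (intro exI[of _ s] conjI runs_weaken[OF runs_WhileFalse])
        (auto simp: 4(1)[symmetric])
  qed
  then obtain s1 where "runs A ?loop s s1 (5 * length (s r) + 6)"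
    "s1(r := tl (s1 r)) = s(r := snd (decode (s q) (s r)), q := fst (decode (s q) (s r)))"
    by blast
  then show ?thesis unfolding decode_program_def
    by (intro runs_weaken[OF runs_Seq[OF _ runs_Pop]]) auto
qed

section \<open>Search for symmetric witnesses with an NP oracle\<close>

text \<open>The length bound moves into the verifier: acceptance alone then implies membership, and
  the simulation can check strings of any length without measuring them.\<close>

lemma NP_verifier:
  assumes "A \<in> NP"
  obtains V p where "polytime_pred2 V" "\<And>x y. V x y \<Longrightarrow> length y \<le> poly p (length x)"
    "\<And>x. x \<in> A \<longleftrightarrow> (\<exists>y. V x y)"
proof -
  obtain V p where V: "polytime_pred2 V" and A: "\<And>x. x \<in> A \<longleftrightarrow> (\<exists>y. length y \<le> poly p (length x) \<and> V x y)"
    using assms unfolding NP_def by blast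
  obtain cV pV where cV: "oracle_free cV" and run_V: "\<And>xs B. length xs = 2 \<Longrightarrow>
      runs B cV (input xs) (input [[V (xs ! 0) (xs ! 1)]]) (poly pV (sum_list (map length xs)))"
    using polytime_clean[OF V[unfolded polytime_pred2_def]] by blast
  obtain cl T where cl: "oracle_free cl" "poly_bounded T" and
    run_cl: "\<And>B s. s 2 = [] \<Longrightarrow> s 4 = [] \<Longrightarrow> s 5 = [] \<Longrightarrow> s 6 = [] \<Longrightarrow>
      runs B cl s (s(2 := replicate (poly p (length (s 0)) - length (s 1)) True,
        3 := replicate (length (s 1) - poly p (length (s 0))) True @ s 3))
      (T (length (s 0) + length (s 1)))"
    using length_comparison_program[of 0 1 2 3 4 5 6 p] by auto
  define V' where "V' x y \<longleftrightarrow> length y \<le> poly p (length x) \<and> V x y" for x y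
  \<comment> \<open>Register 3 is nonempty exactly for an overlong witness. Register 2 keeps the
    opposite difference and is emptied so that \<open>cV\<close> starts on a proper
    \<open>input\<close>.\<close>
  define c where "c = Seq cl (Seq (clear 2)
    (If (NonEmpty 3) (Seq (clear 0) (Push 0 False)) cV))"
  define T' where "T' n = T n + ((2 * poly p n + 1) + Suc (2 * n + 2 + poly pV n))" for n
  have "polytime_pred2 V'"
    unfolding polytime_pred2_def
  proof (rule polytimeI)
    show "oracle_free c" using cl cV by (simp add: c_def)
    show "poly_bounded T'" unfolding T'_def using cl(2)
      by (intro poly_bounded_add poly_bounded_Suc poly_bounded_mult poly_bounded_const poly_bounded_id poly_bounded_poly)
  next
    fix xs :: "bits list" assume "length xs = 2"
    then obtain x y where xs: "xs = [x, y]" by (auto simp: numeral_2_eq_2 length_Suc_conv)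
    let ?N = "length x + length y"
    let ?s = "input [x, y]"
    let ?s1 = "?s(2 := replicate (poly p (length x) - length y) True,
        3 := replicate (length y - poly p (length x)) True)"
    let ?s2 = "?s(3 := replicate (length y - poly p (length x)) True)"
    have 1: "runs {} cl ?s ?s1 (T ?N)"
      by (rule runs_weaken[OF run_cl]) (auto simp: input_def)
    have 2: "runs {} (clear 2) ?s1 ?s2 (2 * poly p ?N + 1)"
      by (rule runs_weaken[OF runs_clear])
        (auto simp: input_def fun_eq_iff intro!: le_trans[OF diff_le_self poly_nat_mono])
    have "\<exists>s'. runs {} (If (NonEmpty 3) (Seq (clear 0) (Push 0 False)) cV) ?s2 s'
        (Suc (2 * ?N + 2 + poly pV ?N)) \<and> s' 0 = [V' x y]"
    proof (cases "length y \<le> poly p (length x)")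
      case True
      then have s2: "?s2 = ?s" by (auto simp: input_def fun_eq_iff)
      have "runs {} cV ?s (input [[V x y]]) (2 * ?N + 2 + poly pV ?N)"
        using run_V[of xs "{}"] by (auto simp: xs elim!: runs_weaken)
      then have "runs {} (If (NonEmpty 3) (Seq (clear 0) (Push 0 False)) cV) ?s2 (input [[V x y]])
        (Suc (2 * ?N + 2 + poly pV ?N))"
        unfolding s2 by (intro runs_IfFalse) (auto simp: input_def)
      then show ?thesis using True by (auto simp: V'_def input_def)
    next
      case False
      let ?s3 = "?s2(0 := [False])"
      have "runs {} (If (NonEmpty 3) (Seq (clear 0) (Push 0 False)) cV) ?s2 ?s3
        (Suc (2 * ?N + 2 + poly pV ?N))"
        by (intro runs_IfTrue runs_weaken[OF runs_Seq[OF runs_clear runs_Push]])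
           (use False in \<open>auto simp: input_def\<close>)
      then show ?thesis using False by (auto simp: V'_def)
    qed
    then obtain s' where 3: "runs {} (If (NonEmpty 3) (Seq (clear 0) (Push 0 False)) cV) ?s2 s'
        (Suc (2 * ?N + 2 + poly pV ?N))" and s': "s' 0 = [V' x y]" by blast
    have "runs {} c ?s s' (T' ?N)" unfolding c_def
      by (rule runs_weaken[OF runs_Seq[OF 1 runs_Seq[OF 2 3]]]) (auto simp: T'_def)
    then show "\<exists>s. runs {} c (input xs) s (T' (sum_list (map length xs))) \<and> s 0 = [V' (xs ! 0) (xs ! 1)]"
      using s' xs by auto
  qed
  then show ?thesis
    by (rule that[of V' p]) (auto simp: V'_def A)
qed

text \<open>An ill-formed \<open>u\<close> counts as refuted by every \<open>z\<close>; this makes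
  the complement of the search relation purely existential, as membership in NP requires.\<close>

definition refutes :: "(bits \<Rightarrow> bits \<Rightarrow> bits \<Rightarrow> bool) \<Rightarrow> nat poly \<Rightarrow> bits \<Rightarrow> bits \<Rightarrow> bits \<Rightarrow> bool" where
  "refutes P q x u z \<longleftrightarrow> u = [] \<or> length (tl u) \<noteq> poly q (length x) \<or>
    length z = poly q (length x) \<and> (if hd u then \<not> P x (tl u) z else P x z (tl u))"

lemma not_S2P_Search: "\<not> S2P_Search P q x u \<longleftrightarrow> (\<exists>z. length z \<le> poly q (length x) \<and> refutes P q x u z)"
proof (cases u)
  case Nil
  then show ?thesis by (auto simp: S2P_Search_def refutes_def intro: exI[of _ "[]"])
next
  case (Cons b w)
  then show ?thesis
    by (cases "length w = poly q (length x)"; cases b)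
       (auto simp: S2P_Search_def refutes_def intro: eq_refl exI[of _ "[]"])
qed

lemma polytime_refutes:
  assumes "polytime_pred3 P"
  shows "polytime_pred2 (\<lambda>e. refutes P q (fst (decode [] e)) (snd (decode [] e)))"
proof -
  obtain cP pP where cP: "oracle_free cP" and run_P: "\<And>xs B. length xs = 3 \<Longrightarrow>
      runs B cP (input xs) (input [[P (xs ! 0) (xs ! 1) (xs ! 2)]]) (poly pP (sum_list (map length xs)))"
    using polytime_clean[OF assms[unfolded polytime_pred3_def]] by blast
  obtain cw Tw where cw: "oracle_free cw" "poly_bounded Tw" and
    run_w: "\<And>B s. s 3 = [] \<Longrightarrow> s 7 = [] \<Longrightarrow> s 8 = [] \<Longrightarrow> s 9 = [] \<Longrightarrow>
      runs B cw s (s(3 := replicate (poly q (length (s 2)) - length (s 0)) True,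
        4 := replicate (length (s 0) - poly q (length (s 2))) True @ s 4))
      (Tw (length (s 2) + length (s 0)))"
    using length_comparison_program[of 2 0 3 4 7 8 9 q] by auto
  obtain cz Tz where cz: "oracle_free cz" "poly_bounded Tz" and
    run_z: "\<And>B s. s 5 = [] \<Longrightarrow> s 7 = [] \<Longrightarrow> s 8 = [] \<Longrightarrow> s 9 = [] \<Longrightarrow>
      runs B cz s (s(5 := replicate (poly q (length (s 2)) - length (s 1)) True,
        6 := replicate (length (s 1) - poly q (length (s 2))) True @ s 6))
      (Tz (length (s 2) + length (s 1)))"
    using length_comparison_program[of 2 1 5 6 7 8 9 q] by auto
  obtain pw pz where pw: "\<And>n. Tw n \<le> poly pw n" and pz: "\<And>n. Tz n \<le> poly pz n"
    using cw(2) cz(2) unfolding poly_bounded_def by auto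
  \<comment> \<open>Once the mark is removed, registers 0, 1, 2 hold \<open>w\<close>,
    \<open>z\<close>, \<open>x\<close>. The program for \<open>P\<close> sees them as
    \<open>x\<close>, \<open>w\<close>, \<open>z\<close> through \<open>f\<close> and as
    \<open>x\<close>, \<open>z\<close>, \<open>w\<close> through \<open>g\<close>; either way its
    verdict lands in register 2, the image of 0.\<close>
  define f where "f r = (if r = 0 then 2 else if r = 1 then 0 else if r = 2 then 1 else r)" for r :: nat
  define g where "g r = (if r = 0 then 2 else if r = 2 then 0 else r)" for r :: nat
  have f: "inj f" "\<And>r. r \<in> range f"
    using range_eqI[of 0 f 1] range_eqI[of 1 f 2] range_eqI[of 2 f 0] range_eqI[of _ f]
    by (auto simp: f_def inj_def split: if_splits)
  have g: "inj g" "\<And>r. r \<in> range g"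
    using range_eqI[of 0 g 2] range_eqI[of 2 g 0] range_eqI[of _ g]
    by (auto simp: g_def inj_def split: if_splits)
  define reply where "reply b = Seq (clear 0) (Push 0 b)" for b
  \<comment> \<open>The parameter \<open>b\<close> is the value of \<open>P\<close> that refutes:
    \<open>False\<close> against a first-player witness, \<open>True\<close> against a second-player
    witness.\<close>
  define core where "core = (\<lambda>d b. Seq d (If (TopOne 2) (reply b) (reply (\<not> b))))"
  define check where "check = (\<lambda>c. Seq cw (Seq cz
    (If (NonEmpty 3) (reply True) (If (NonEmpty 4) (reply True)
    (If (NonEmpty 5) (reply False) (If (NonEmpty 6) (reply False) c))))))"
  define c where "c = Seq (decode_program 0 2) (If (NonEmpty 0)
    (If (TopOne 0) (Seq (Pop 0) (check (core (rename f cP) False)))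
                   (Seq (Pop 0) (check (core (rename g cP) True))))
    (reply True))"
  define E where "E n = poly pP n + 2 * n + 10" for n
  define T' where "T' n = 5 * n + 20 + poly pw n + poly pz n + E n" for n
  have reply: "\<exists>s'. runs {} (reply b) s s' (2 * n + 2) \<and> s' 0 = [b]" if "length (s 0) \<le> n" for s b n
    unfolding reply_def
    by (intro exI conjI, rule runs_weaken[OF runs_Seq[OF runs_clear runs_Push] refl]) (use that in auto)
  have core: "\<exists>s'. runs {} (core d b) s s' (poly pP n + 10) \<and> s' 0 = [v = b]"
    if d: "runs {} d s s1 (poly pP n)" "s1 0 = []" "s1 2 = [v]" for d b s s1 v n
  proof -
    obtain s' where "runs {} (reply (v = b)) s1 s' (2 * 0 + 2)" "s' 0 = [v = b]"
      using reply[of s1 0 "v = b"] d(2) by auto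
    moreover from this have "runs {} (If (TopOne 2) (reply b) (reply (\<not> b))) s1 s' (Suc (2 * 0 + 2))"
      using d(3) by (intro runs_If) auto
    ultimately show ?thesis unfolding core_def
      by (intro exI[of _ s'] conjI runs_weaken[OF runs_Seq[OF d(1)]]) auto
  qed
  have check: "\<exists>s'. runs {} (check d) (input [w, z, x]) s' (poly pw n + poly pz n + E n + 4) \<and>
      s' 0 = [length w \<noteq> poly q (length x) \<or> length z = poly q (length x) \<and> a]"
    if n: "length w + length z + length x \<le> n"
      and d: "\<exists>s'. runs {} d (input [w, z, x]) s' (poly pP n + 10) \<and> s' 0 = [a]" for d w z x n a
  proof -
    let ?s = "input [w, z, x]" and ?m = "poly q (length x)"
    let ?s1 = "?s(3 := replicate (?m - length w) True, 4 := replicate (length w - ?m) True)"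
    let ?s2 = "?s1(5 := replicate (?m - length z) True, 6 := replicate (length z - ?m) True)"
    let ?d = "If (NonEmpty 3) (reply True) (If (NonEmpty 4) (reply True)
      (If (NonEmpty 5) (reply False) (If (NonEmpty 6) (reply False) d)))"
    have "Tw (length x + length w) \<le> poly pw n" "Tz (length x + length z) \<le> poly pz n"
      using n by (auto intro!: le_trans[OF pw] le_trans[OF pz] poly_nat_mono)
    then have 1: "runs {} cw ?s ?s1 (poly pw n)" and 2: "runs {} cz ?s1 ?s2 (poly pz n)"
      by (auto intro!: runs_weaken[OF run_w] runs_weaken[OF run_z] simp: input_def)
    have rep: "\<exists>s'. runs {} (reply b) ?s2 s' (E n) \<and> s' 0 = [b]" for b
      using reply[of ?s2 n b] n by (auto simp: E_def input_def elim!: runs_weaken)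
    have d': "\<exists>s'. runs {} d ?s s' (E n) \<and> s' 0 = [a]"
      using d by (auto simp: E_def elim!: runs_weaken)
    have "\<exists>s'. runs {} ?d ?s2 s' (E n + 4) \<and> s' 0 = [length w \<noteq> ?m \<or> length z = ?m \<and> a]"
    proof (cases "length w = ?m \<and> length z = ?m")
      case True
      \<comment> \<open>All four difference registers are empty, so the cleaned program for
        \<open>P\<close> applies.\<close>
      then have "?s2 = ?s" by (auto simp: input_def fun_eq_iff)
      moreover obtain s' where "runs {} d ?s s' (E n)" "s' 0 = [a]" using d' by auto
      moreover from this have "runs {} ?d ?s s' (E n + 4)"
        by (intro runs_weaken[OF runs_IfFalse[OF _ runs_IfFalse[OF _ runs_IfFalse[OF _ runs_IfFalse]]] refl])
           (auto simp: input_def)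
      ultimately show ?thesis using True by (intro exI[of _ s']) simp
    next
      case False
      show ?thesis
      proof (cases "length w = ?m")
        case True
        obtain s' where "runs {} (reply False) ?s2 s' (E n)" "s' 0 = [False]" using rep by auto
        moreover from this have *: "runs {} (If (NonEmpty 5) (reply False) (If (NonEmpty 6) (reply False) d)) ?s2 s' (E n + 2)"
          using True False
          by (cases "?m - length z = 0")
             (auto intro: runs_weaken[OF runs_IfTrue] runs_weaken[OF runs_IfFalse[OF _ runs_IfTrue]])
        have "runs {} ?d ?s2 s' (E n + 4)"
          by (rule runs_weaken[OF runs_IfFalse[OF _ runs_IfFalse[OF _ *]] refl]) (use True in auto)
        ultimately show ?thesis using True False by (intro exI[of _ s']) simp
      next
        case False
        obtain s' where "runs {} (reply True) ?s2 s' (E n)" "s' 0 = [True]" using rep by auto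
        moreover from this have "runs {} ?d ?s2 s' (E n + 4)"
          using False
          by (cases "?m - length w = 0")
             (auto intro: runs_weaken[OF runs_IfTrue] runs_weaken[OF runs_IfFalse[OF _ runs_IfTrue]])
        ultimately show ?thesis using False by auto
      qed
    qed
    then obtain s' where "runs {} ?d ?s2 s' (E n + 4)" "s' 0 = [length w \<noteq> ?m \<or> length z = ?m \<and> a]"
      by blast
    then show ?thesis unfolding check_def
      by (intro exI[of _ s'] conjI runs_weaken[OF runs_Seq[OF 1 runs_Seq[OF 2]]]) auto
  qed
  show ?thesis unfolding polytime_pred2_def
  proof (rule polytimeI)
    show "oracle_free c" using cP cw cz by (simp add: c_def check_def core_def reply_def)
    show "poly_bounded T'" unfolding T'_def E_def
      by (intro poly_bounded_add poly_bounded_mult poly_bounded_const poly_bounded_id poly_bounded_poly)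
  next
    fix xs :: "bits list" assume "length xs = 2"
    then obtain e z where xs: "xs = [e, z]" by (auto simp: numeral_2_eq_2 length_Suc_conv)
    obtain x u where xu: "decode [] e = (x, u)" by force
    define n where "n = length e + length z"
    have n: "length u + length z + length x \<le> n"
      using length_decode[of "[]" e] xu by (simp add: n_def)
    have 1: "runs {} (decode_program 0 2) (input [e, z]) (input [u, z, x]) (5 * n + 7)"
      by (rule runs_weaken[OF runs_decode]) (auto simp: xu input_def n_def fun_eq_iff)
    let ?c = "If (NonEmpty 0)
      (If (TopOne 0) (Seq (Pop 0) (check (core (rename f cP) False)))
                     (Seq (Pop 0) (check (core (rename g cP) True))))
      (reply True)"
    have "\<exists>s'. runs {} ?c (input [u, z, x]) s' (poly pw n + poly pz n + E n + 10) \<and> s' 0 = [refutes P q x u z]"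
    proof (cases u)
      case Nil
      obtain s' where "runs {} (reply True) (input [u, z, x]) s' (2 * n + 2)" "s' 0 = [True]"
        using reply[of "input [u, z, x]" n True] n by (auto simp: input_def)
      then show ?thesis
        by (intro exI[of _ s'] conjI runs_weaken[OF runs_IfFalse]) (auto simp: Nil input_def refutes_def E_def)
    next
      case (Cons b w)
      have w: "length w + length z + length x \<le> n" using n Cons by simp
      have pop: "runs {} (Pop 0) (input [u, z, x]) (input [w, z, x]) 1"
        by (rule runs_weaken[OF runs_Pop]) (auto simp: Cons input_def fun_eq_iff)
      show ?thesis
      proof (cases b)
        case True
        have "runs {} (rename f cP) (input [w, z, x]) (\<lambda>r. if r = 2 then [P x w z] else []) (poly pP n)"
        proof (rule runs_rename[OF _ f(1)])
          have "input [w, z, x] \<circ> f = input [x, w, z]"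
            by (auto simp: fun_eq_iff input_def f_def)
          then show "runs {} cP (input [w, z, x] \<circ> f) (input [[P x w z]]) (poly pP n)"
            using w by (auto intro!: runs_weaken[OF run_P[of "[x, w, z]"]] poly_nat_mono)
        qed (use f(2) in \<open>auto simp: fun_eq_iff input_def f_def\<close>)
        from check[OF w core[OF this, of "P x w z" False]]
        obtain s' where "runs {} (check (core (rename f cP) False)) (input [w, z, x]) s' (poly pw n + poly pz n + E n + 4)"
          "s' 0 = [refutes P q x u z]"
          using True Cons by (auto simp: refutes_def)
        then show ?thesis using True
          by (intro exI[of _ s'] conjI runs_weaken[OF runs_IfTrue[OF _ runs_IfTrue[OF _ runs_Seq[OF pop]]]])
             (auto simp: Cons input_def)
      next
        case False
        have "runs {} (rename g cP) (input [w, z, x]) (\<lambda>r. if r = 2 then [P x z w] else []) (poly pP n)"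
        proof (rule runs_rename[OF _ g(1)])
          have "input [w, z, x] \<circ> g = input [x, z, w]"
            by (auto simp: fun_eq_iff input_def g_def)
          then show "runs {} cP (input [w, z, x] \<circ> g) (input [[P x z w]]) (poly pP n)"
            using w by (auto intro!: runs_weaken[OF run_P[of "[x, z, w]"]] poly_nat_mono)
        qed (use g(2) in \<open>auto simp: fun_eq_iff input_def g_def\<close>)
        from check[OF w core[OF this, of "P x z w" True]]
        obtain s' where "runs {} (check (core (rename g cP) True)) (input [w, z, x]) s' (poly pw n + poly pz n + E n + 4)"
          "s' 0 = [refutes P q x u z]"
          using False Cons by (auto simp: refutes_def)
        then show ?thesis using False
          by (intro exI[of _ s'] conjI runs_weaken[OF runs_IfTrue[OF _ runs_IfFalse[OF _ runs_Seq[OF pop]]]])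
             (auto simp: Cons input_def)
      qed
    qed
    then obtain s' where 2: "runs {} ?c (input [u, z, x]) s' (poly pw n + poly pz n + E n + 10)"
      and s': "s' 0 = [refutes P q x u z]" by blast
    have "runs {} c (input [e, z]) s' (T' n)" unfolding c_def
      by (rule runs_weaken[OF runs_Seq[OF 1 2]]) (auto simp: T'_def)
    then show "\<exists>s. runs {} c (input xs) s (T' (sum_list (map length xs))) \<and>
        s 0 = [refutes P q (fst (decode [] (xs ! 0))) (snd (decode [] (xs ! 0))) (xs ! 1)]"
      using s' by (auto simp: xs xu n_def)
  qed
qed

lemma TFNP_NP_S2P_Search:
  assumes "S2P_predicate P q"
  shows "TFNP_NP (S2P_Search P q)"
proof -
  obtain L where L: "S2P_defines P q L" using assms unfolding S2P_predicate_def by auto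
  then have P: "polytime_pred3 P" unfolding S2P_defines_def by simp
  define A where "A = {e. \<not> S2P_Search P q (fst (decode [] e)) (snd (decode [] e))}"
  have "A \<in> NP" unfolding NP_def
  proof (intro CollectI exI conjI allI)
    show "polytime_pred2 (\<lambda>e. refutes P q (fst (decode [] e)) (snd (decode [] e)))"
      by (rule polytime_refutes[OF P])
    fix e
    let ?x = "fst (decode [] e)" and ?u = "snd (decode [] e)"
    have "poly q (length ?x) \<le> poly q (length e)"
      using length_decode[of "[]" e] by (auto intro!: poly_nat_mono)
    \<comment> \<open>NP bounds \<open>z\<close> by the length of the code \<open>e\<close>, which
      may admit strings longer than a move. Such a string refutes only an ill-formed
      \<open>u\<close>, and then the empty string does as well.\<close>
    moreover have "\<exists>z'. length z' \<le> poly q (length ?x) \<and> refutes P q ?x ?u z'" if "refutes P q ?x ?u z" for z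
      using that by (cases "length z \<le> poly q (length ?x)")
        (auto simp: refutes_def intro: exI[of _ "[]"])
    ultimately show "e \<in> A \<longleftrightarrow> (\<exists>z. length z \<le> poly q (length e) \<and> refutes P q ?x ?u z)"
      unfolding A_def not_S2P_Search by (auto intro: le_trans)
  qed
  moreover have "computes_polytime A
      (Seq (Push 1 False) (Seq (encode_program 0 1) (Seq (Query 1) (If (TopOne 1) (Push 0 False) (Push 0 True))))) 2
      (\<lambda>xs. [S2P_Search P q (xs ! 0) (xs ! 1)])" (is "computes_polytime A ?c 2 _")
  proof (rule computes_polytimeI[where T = "\<lambda>n. 5 * n + 5"])
    show "poly_bounded (\<lambda>n. 5 * n + 5)"
      by (intro poly_bounded_add poly_bounded_mult poly_bounded_const poly_bounded_id)
    fix xs :: "bits list" assume "length xs = 2"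
    then obtain x u where xs: "xs = [x, u]" by (auto simp: numeral_2_eq_2 length_Suc_conv)
    let ?s = "input [[], [pair x u \<in> A]]"
    have q: "runs A (Query 1) (input [[], pair x u]) ?s 1"
      by (rule runs_weaken[OF runs_Query]) (auto simp: input_def fun_eq_iff less_Suc_eq)
    have a: "runs A (If (TopOne 1) (Push 0 False) (Push 0 True)) ?s
        (?s(0 := [S2P_Search P q x u])) (Suc 1)"
      by (rule runs_If; rule runs_weaken[OF runs_Push]) (auto simp: input_def A_def)
    have e: "runs A (encode_program 0 1) ((input [x, u])(1 := False # u)) (input [[], pair x u]) (5 * length x + 1)"
      by (rule runs_weaken[OF runs_encode]) (auto simp: input_def fun_eq_iff less_Suc_eq)
    have p: "runs A (Push 1 False) (input [x, u]) ((input [x, u])(1 := False # u)) 1"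
      by (rule runs_weaken[OF runs_Push]) (auto simp: input_def)
    have "runs A ?c (input [x, u]) (?s(0 := [S2P_Search P q x u])) (5 * (length x + length u) + 5)"
      by (rule runs_weaken[OF runs_Seq[OF p runs_Seq[OF e runs_Seq[OF q a]]]]) auto
    then show "\<exists>s. runs A ?c (input xs) s (5 * sum_list (map length xs) + 5) \<and>
        s 0 = [S2P_Search P q (xs ! 0) (xs ! 1)]"
      unfolding xs by (intro exI[of _ "?s(0 := [S2P_Search P q x u])"]) simp
  qed
  ultimately have "P_NP_rel (S2P_Search P q)" unfolding P_NP_rel_def by blast
  moreover have "\<exists>u. S2P_Search P q x u" for x
    using L unfolding S2P_defines_def S2P_Search_def by blast
  \<comment> \<open>The additional 1 pays for the marking bit.\<close>
  moreover have "length u \<le> poly (q + 1) (length x)" if "S2P_Search P q x u" for x u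
    using that unfolding S2P_Search_def by auto
  ultimately show ?thesis unfolding TFNP_NP_def by blast
qed

section \<open>Simulating an oracle computation from a claimed transcript\<close>

text \<open>
  Register \<open>r\<close> of the simulated program is register \<open>3 * r\<close>, register \<open>i\<close> of the witness verifier
  is register \<open>3 * i + 2\<close>. Register 1 holds the unread transcript \<open>y\<close>, register 4 the decoded second
  move \<open>z\<close>, register 7 is nonempty once the transcript is refuted, register 10 is the loop flag, and
  registers 13, 16 and 19 are scratch space.
\<close>

definition sim_store :: "store \<Rightarrow> bits \<Rightarrow> bits \<Rightarrow> bits \<Rightarrow> store" where
  "sim_store s y z f = (\<lambda>r. if r mod 3 = 0 then s (r div 3) else if r = 1 then y
     else if r = 4 then z else if r = 7 then f else [])"

lemma three_times_neq [simp]: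
  "3 * r \<noteq> (1 :: nat)" "3 * r \<noteq> Suc 0" "3 * r \<noteq> (2 :: nat)" "3 * r \<noteq> (4 :: nat)" "3 * r \<noteq> (5 :: nat)"
  "3 * r \<noteq> (7 :: nat)" "3 * r \<noteq> (10 :: nat)" "3 * r \<noteq> (13 :: nat)" "3 * r \<noteq> (16 :: nat)"
  by presburger+

lemma sim_store_simps [simp]:
  "sim_store s y z f (3 * r) = s r" "sim_store s y z f 0 = s 0"
  "sim_store s y z f (Suc 0) = y" "sim_store s y z f 4 = z" "sim_store s y z f 7 = f"
  "sim_store s y z f 2 = []" "sim_store s y z f 5 = []" "sim_store s y z f 10 = []"
  "sim_store s y z f 13 = []" "sim_store s y z f 16 = []"
  "sim_store s y z f \<circ> (*) 3 = s"
  by (auto simp: sim_store_def)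

lemma sim_store_upd [simp]:
  "(sim_store s y z f)(3 * r := w) = sim_store (s(r := w)) y z f"
  "(sim_store s y z f)(Suc 0 := w) = sim_store s w z f"
  "(sim_store s y z f)(7 := w) = sim_store s y z w"
  "(sim_store s y z f)(2 := []) = sim_store s y z f"
  "(sim_store s y z f)(10 := []) = sim_store s y z f"
  by (auto simp: sim_store_def fun_eq_iff)

text \<open>The loop flag is set only in exchange for a transcript bit. If the guard holds but no
  bit is left, the flag stays empty and the claim is marked as refuted, so the loop stops.\<close>

definition tick :: "test \<Rightarrow> com" where
  "tick b = If (rename_test ((*) 3) b)
    (If (NonEmpty 1) (Seq (Pop 1) (Push 10 True)) (Push 7 True)) Skip"

text \<open>The flag is removed before the body starts, so nested loops can share register
  10.\<close>

definition loop :: "test \<Rightarrow> com \<Rightarrow> com" where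
  "loop b c = While (NonEmpty 10) (Seq (Pop 10) (Seq c (tick b)))"

text \<open>A claimed positive answer is followed by a coded witness, checked at once. A negative
  one is tested against the second move, which is copied because it is tried on every such query. An
  exhausted transcript reads as a negative answer.\<close>

definition ask :: "com \<Rightarrow> nat \<Rightarrow> com" where
  "ask v r = Seq (move r 16) (Seq (move 16 2) (If (TopOne 1)
    (Seq (Pop 1) (Seq (decode_program 1 5) (Seq v
      (Seq (If (TopOne 2) Skip (Push 7 True)) (Seq (Pop 2) (Push r True))))))
    (Seq (Pop 1) (Seq (copy 4 5 13) (Seq v
      (Seq (If (TopOne 2) (Push 7 True) Skip) (Seq (Pop 2) (Push r False))))))))"

fun simulate :: "com \<Rightarrow> com \<Rightarrow> com" where
  "simulate v Skip = Skip"
| "simulate v (Push r b) = Push (3 * r) b"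
| "simulate v (Pop r) = Pop (3 * r)"
| "simulate v (Query r) = ask (rename (\<lambda>i. 3 * i + 2) v) (3 * r)"
| "simulate v (Seq c d) = Seq (simulate v c) (simulate v d)"
| "simulate v (If b c d) = If (rename_test ((*) 3) b) (simulate v c) (simulate v d)"
| "simulate v (While b c) = Seq (tick b) (loop b (simulate v c))"

text \<open>Chosen so that a simulation consuming \<open>d\<close> transcript bits takes at most
  \<open>weight c * (1 + d)\<close> units, each no dearer than the largest query. The 6 is the
  overhead of an iteration: 4 for the tick, 1 for the flag test, 1 for removing the flag.\<close>

fun weight :: "com \<Rightarrow> nat" where
  "weight (Seq c d) = weight c + weight d"
| "weight (If b c d) = weight c + weight d + 1"
| "weight (While b c) = weight c + 6"
| "weight _ = 1"

lemma oracle_free_simulate: "oracle_free v \<Longrightarrow> oracle_free (simulate v c)"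
  by (induction c) (auto simp: ask_def tick_def loop_def)

lemma runs_tick:
  "runs A (tick b) (sim_store s y z f)
    (if holds b s then if y = [] then sim_store s y z (True # f)
       else (sim_store s (tl y) z f)(10 := [True])
     else sim_store s y z f) 4"
proof -
  have "runs A (If (NonEmpty 1) (Seq (Pop 1) (Push 10 True)) (Push 7 True)) (sim_store s y z f)
    (if y = [] then sim_store s y z (True # f) else (sim_store s (tl y) z f)(10 := [True])) (Suc 2)"
    by (rule runs_If; (rule runs_weaken[OF runs_Seq[OF runs_Pop runs_Push]] runs_weaken[OF runs_Push])) auto
  then have "runs A (tick b) (sim_store s y z f)
    (if holds b s then if y = [] then sim_store s y z (True # f)
       else (sim_store s (tl y) z f)(10 := [True])
     else sim_store s y z f) (Suc 3)"
    unfolding tick_def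
    by (intro runs_If) (auto intro: runs_weaken[OF runs_Skip] elim: runs_weaken)
  then show ?thesis by (rule runs_weaken) auto
qed

lemma runs_simulate_If:
  assumes "runs A (simulate v (if holds b s then c else d)) (sim_store s y z f) \<sigma> T"
  shows "runs A (simulate v (If b c d)) (sim_store s y z f) \<sigma> (Suc T)"
  unfolding simulate.simps by (rule runs_If) (use assms in auto)

lemma runs_loop_exit: "runs A (loop b c) (sim_store s y z f) (sim_store s y z f) 1"
  unfolding loop_def by (rule runs_WhileFalse) simp

lemma runs_simulate_While_exit:
  assumes "\<not> holds b s"
  shows "runs A (simulate v (While b c)) (sim_store s y z f) (sim_store s y z f) 5"
proof -
  have 1: "runs A (tick b) (sim_store s y z f) (sim_store s y z f) 4"
    using runs_tick[of A b s y z f] assms by simp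
  show ?thesis unfolding simulate.simps
    by (rule runs_weaken[OF runs_Seq[OF 1 runs_loop_exit]]) auto
qed

lemma runs_simulate_While_fail:
  assumes "holds b s"
  shows "runs A (simulate v (While b c)) (sim_store s [] z f) (sim_store s [] z (True # f)) 5"
proof -
  have 1: "runs A (tick b) (sim_store s [] z f) (sim_store s [] z (True # f)) 4"
    using runs_tick[of A b s "[]" z f] assms by simp
  show ?thesis unfolding simulate.simps
    by (rule runs_weaken[OF runs_Seq[OF 1 runs_loop_exit]]) auto
qed

text \<open>The tick that closes the first iteration doubles as the opening tick of the remaining
  loop. Thus \<open>simulate v (While b c)\<close> unfolds like a loop although it is a
  sequence.\<close>

lemma runs_simulate_While_step:
  assumes "holds b s"
    and c: "runs A (simulate v c) (sim_store s y z f) (sim_store s1 y1 z f1) T1"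
    and w: "runs A (simulate v (While b c)) (sim_store s1 y1 z f1) s2 T2"
  shows "runs A (simulate v (While b c)) (sim_store s (e # y) z f) s2 (T1 + T2 + 6)"
proof -
  let ?s = "(sim_store s y z f)(10 := [True])"
  obtain s' t t' where t: "exec A (tick b) (sim_store s1 y1 z f1) t s'"
      "exec A (loop b (simulate v c)) s' t' s2" "t + t' \<le> T2"
    using w by (auto simp: runs_def elim!: exec_elims(5))
  then have 1: "runs A (tick b) (sim_store s1 y1 z f1) s' t" "runs A (loop b (simulate v c)) s' s2 t'"
    by (auto simp: runs_def)
  have 2: "runs A (Pop 10) ?s (sim_store s y z f) 1"
    by (rule runs_weaken[OF runs_Pop]) auto
  have 3: "runs A (loop b (simulate v c)) ?s s2 (Suc (1 + (T1 + t) + t'))"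
    unfolding loop_def
    by (rule runs_WhileTrue[OF _ runs_Seq[OF 2 runs_Seq[OF c 1(1)]] 1(2)[unfolded loop_def]]) simp
  have 4: "runs A (tick b) (sim_store s (e # y) z f) ?s 4"
    using runs_tick[of A b s "e # y" z f] assms by simp
  show ?thesis unfolding simulate.simps
    by (rule runs_weaken[OF runs_Seq[OF 4 3]]) (use t(3) in auto)
qed

lemma exI4: "P a b c d \<Longrightarrow> \<exists>a b c d. P a b c d"
  by blast

section \<open>Simulation relative to a fixed NP verifier\<close>

locale query_verifier =
  fixes v :: com and V :: "bits \<Rightarrow> bits \<Rightarrow> bool" and pV :: "nat poly"
  assumes oracle_free_v: "oracle_free v"
    and runs_v: "runs {} v (input [x, y]) (input [[V x y]]) (poly pV (length x + length y))"
begin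

text \<open>The effect of \<open>ask\<close> as a function: answer, unread transcript, refutation
  marks. The last equation also covers the empty transcript.\<close>

fun respond :: "bits \<Rightarrow> bits \<Rightarrow> bits \<Rightarrow> bits \<Rightarrow> bool \<times> bits \<times> bits" where
  "respond u (True # e) z f =
    (True, snd (decode [] e), if V u (fst (decode [] e)) then f else True # f)"
| "respond u y z f = (False, tl y, if V u z then True # f else f)"

definition ask_cost :: "nat \<Rightarrow> nat" where
  "ask_cost n = 20 * n + 30 + poly pV n"

lemma ask_cost_mono: "m \<le> n \<Longrightarrow> ask_cost m \<le> ask_cost n"
  by (auto simp: ask_cost_def intro!: add_mono poly_nat_mono)

lemma length_respond: "respond u y z f = (a, y', f') \<Longrightarrow> length y' \<le> length y"
  using length_decode[of "[]" "tl y"] by (induction u y z f rule: respond.induct) auto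

lemma respond_flag: "respond u y z f = (a, y', f') \<Longrightarrow> f \<noteq> [] \<Longrightarrow> f' \<noteq> []"
  by (induction u y z f rule: respond.induct) (auto split: if_splits)

lemma runs_verify:
  "runs {} (rename (\<lambda>i. 3 * i + 2) v) ((sim_store s y z f)(2 := u, 5 := w))
    ((sim_store s y z f)(2 := [V u w])) (poly pV (length u + length w))"
proof (rule runs_rename)
  have ne: "3 * i + 2 \<noteq> 7" "3 * i + 2 \<noteq> 4" "3 * i + 2 \<noteq> 1" "(3 * i + 2) mod 3 \<noteq> 0"
    "3 * i + 2 = 2 \<longleftrightarrow> i = 0" "3 * i + 2 = 5 \<longleftrightarrow> i = 1" "\<not> 3 dvd Suc (Suc (3 * i))" for i :: nat
    by presburger+
  have *: "(sim_store s y z f)(2 := u, 5 := w) \<circ> (\<lambda>i. 3 * i + 2) = input [u, w]"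
    unfolding comp_def fun_upd_def sim_store_def ne(1-6)
    by (auto simp: input_def fun_eq_iff less_Suc_eq ne(7))
  show "runs {} v ((sim_store s y z f)(2 := u, 5 := w) \<circ> (\<lambda>i. 3 * i + 2)) (input [[V u w]])
    (poly pV (length u + length w))"
    unfolding * by (rule runs_v)
  show "(sim_store s y z f)(2 := [V u w]) \<circ> (\<lambda>i. 3 * i + 2) = input [[V u w]]"
    unfolding comp_def fun_upd_def sim_store_def ne(1-6)
    by (auto simp: input_def fun_eq_iff less_Suc_eq ne(7))
  show "((sim_store s y z f)(2 := [V u w])) r = ((sim_store s y z f)(2 := u, 5 := w)) r"
    if "r \<notin> range (\<lambda>i. 3 * i + 2)" for r
    using that range_eqI[of 2 "\<lambda>i. 3 * i + 2" 0] range_eqI[of 5 "\<lambda>i. 3 * i + 2" 1]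
    by (auto simp: fun_upd_def)
qed (auto simp: inj_def)

lemma runs_ask:
  assumes "respond (s r) y z f = (a, y', f')"
  shows "runs {} (simulate v (Query r)) (sim_store s y z f) (sim_store (s(r := [a])) y' z f')
    (ask_cost (length (s r) + length y + length z))"
proof -
  let ?u = "s r" and ?s = "sim_store (s(r := [])) y z f"
  let ?v = "rename (\<lambda>i. 3 * i + 2) v"
  have 1: "runs {} (move (3 * r) 16) (sim_store s y z f) (?s(16 := rev ?u)) (4 * length ?u + 1)"
    by (rule runs_weaken[OF runs_move]) auto
  have 2: "runs {} (move 16 2) (?s(16 := rev ?u)) (?s(2 := ?u)) (4 * length ?u + 1)"
    by (rule runs_weaken[OF runs_move]) (auto simp: fun_eq_iff sim_store_def)
  let ?yes = "Seq (Pop 1) (Seq (decode_program 1 5) (Seq ?v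
      (Seq (If (TopOne 2) Skip (Push 7 True)) (Seq (Pop 2) (Push (3 * r) True)))))"
  let ?no = "Seq (Pop 1) (Seq (copy 4 5 13) (Seq ?v
      (Seq (If (TopOne 2) (Push 7 True) Skip) (Seq (Pop 2) (Push (3 * r) False)))))"
  let ?n = "length ?u + length y + length z"
  have 3: "runs {} (If (TopOne 1) ?yes ?no) (?s(2 := ?u)) (sim_store (s(r := [a])) y' z f')
     (Suc (9 * ?n + 20 + poly pV ?n))"
  proof (cases "\<exists>e. y = True # e")
    case True
    then obtain e where y: "y = True # e" by auto
    let ?w = "fst (decode [] e)"
    have a: "a" "y' = snd (decode [] e)" "f' = (if V ?u ?w then f else True # f)"
      using assms y by auto
    let ?s1 = "sim_store (s(r := [])) e z f" and ?s2 = "sim_store (s(r := [])) y' z f"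
      and ?s3 = "sim_store (s(r := [])) y' z f'"
    have i: "runs {} (Pop 1) (?s(2 := ?u)) (?s1(2 := ?u)) 1"
      by (rule runs_weaken[OF runs_Pop]) (auto simp: y fun_eq_iff sim_store_def)
    have ii: "runs {} (decode_program 1 5) (?s1(2 := ?u)) (?s2(2 := ?u, 5 := ?w)) (5 * length e + 7)"
      by (rule runs_weaken[OF runs_decode]) (auto simp: a fun_eq_iff sim_store_def)
    have iii: "runs {} (If (TopOne 2) Skip (Push 7 True)) (?s2(2 := [V ?u ?w])) (?s3(2 := [V ?u ?w])) (Suc 1)"
      by (rule runs_If; (rule runs_weaken[OF runs_Skip] runs_weaken[OF runs_Push]))
         (auto simp: a fun_eq_iff sim_store_def)
    have iv: "runs {} (Pop 2) (?s3(2 := [V ?u ?w])) ?s3 1"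
      by (rule runs_weaken[OF runs_Pop]) auto
    have vv: "runs {} (Push (3 * r) True) ?s3 (sim_store (s(r := [a])) y' z f') 1"
      by (rule runs_weaken[OF runs_Push]) (auto simp: a)
    have "length ?w \<le> length e" using length_decode[of "[]" e] by simp
    then have "poly pV (length ?u + length ?w) \<le> poly pV ?n"
      by (intro poly_nat_mono) (simp add: y)
    then have "runs {} ?yes (?s(2 := ?u)) (sim_store (s(r := [a])) y' z f') (9 * ?n + 20 + poly pV ?n)"
      by (intro runs_weaken[OF runs_Seq[OF i runs_Seq[OF ii runs_Seq[OF runs_verify runs_Seq[OF iii runs_Seq[OF iv vv]]]]] refl])
         (simp add: y)
    then show ?thesis by (intro runs_IfTrue) (auto simp: y)
  next
    case False
    then have a: "\<not> a" "y' = tl y" "f' = (if V ?u z then True # f else f)"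
      using assms by (cases "(?u, y, z, f)" rule: respond.cases, auto)+
    let ?s1 = "sim_store (s(r := [])) y' z f" and ?s3 = "sim_store (s(r := [])) y' z f'"
    have i: "runs {} (Pop 1) (?s(2 := ?u)) (?s1(2 := ?u)) 1"
      by (rule runs_weaken[OF runs_Pop]) (auto simp: a fun_eq_iff sim_store_def)
    have ii: "runs {} (copy 4 5 13) (?s1(2 := ?u)) (?s1(2 := ?u, 5 := z)) (9 * length z + 2)"
      by (rule runs_weaken[OF runs_copy]) (auto simp: a)
    have iii: "runs {} (If (TopOne 2) (Push 7 True) Skip) (?s1(2 := [V ?u z])) (?s3(2 := [V ?u z])) (Suc 1)"
      by (rule runs_If; (rule runs_weaken[OF runs_Skip] runs_weaken[OF runs_Push]))
         (auto simp: a fun_eq_iff sim_store_def)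
    have iv: "runs {} (Pop 2) (?s3(2 := [V ?u z])) ?s3 1"
      by (rule runs_weaken[OF runs_Pop]) auto
    have vv: "runs {} (Push (3 * r) False) ?s3 (sim_store (s(r := [a])) y' z f') 1"
      by (rule runs_weaken[OF runs_Push]) (auto simp: a)
    have "poly pV (length ?u + length z) \<le> poly pV ?n"
      by (intro poly_nat_mono) simp
    then have "runs {} ?no (?s(2 := ?u)) (sim_store (s(r := [a])) y' z f') (9 * ?n + 20 + poly pV ?n)"
      by (intro runs_weaken[OF runs_Seq[OF i runs_Seq[OF ii runs_Seq[OF runs_verify runs_Seq[OF iii runs_Seq[OF iv vv]]]]] refl])
         simp
    then show ?thesis using False by (intro runs_IfFalse) auto
  qed
  show ?thesis unfolding simulate.simps ask_def
    by (rule runs_weaken[OF runs_Seq[OF 1 runs_Seq[OF 2 3]]]) (auto simp: ask_cost_def)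
qed

text \<open>Halting holds even for dishonest moves, since every iteration consumes a bit. The number
  \<open>d\<close> of consumed bits pays for time and for growth of registers. \<open>M\<close> and
  \<open>L\<close> stay fixed along the run while \<open>m\<close> and \<open>y\<close> change,
  which gives all queries a common cost bound.\<close>

lemma simulate_total:
  assumes "\<And>r. length (s r) \<le> m" "length y \<le> L" "m + weight c * (1 + length y) \<le> M"
  shows "\<exists>s' y' f' d. runs {} (simulate v c) (sim_store s y z f) (sim_store s' y' z f')
      (weight c * (1 + d) * ask_cost (M + L + length z)) \<and>
    length y = length y' + d \<and> (\<forall>r. length (s' r) \<le> m + weight c * (1 + d)) \<and> (f \<noteq> [] \<longrightarrow> f' \<noteq> [])"
  using assms
proof (induction c arbitrary: s y f m)
  case Skip
  have "1 \<le> ask_cost (M + L + length z)" by (simp add: ask_cost_def)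
  then show ?case using Skip
    by (intro exI4[of _ s y f 0])
      (auto intro!: runs_weaken[OF runs_Skip] intro: le_SucI)
next
  case (Push r b)
  define s' where "s' = s(r := b # s r)"
  have "runs {} (simulate v (Push r b)) (sim_store s y z f) (sim_store s' y z f)
      (weight (Push r b) * (1 + 0) * ask_cost (M + L + length z))"
    unfolding simulate.simps s'_def by (rule runs_weaken[OF runs_Push]) (auto simp: ask_cost_def)
  moreover have "length (s' i) \<le> m + 1" for i
    using Push(1)[of i] Push(1)[of r] by (auto simp: s'_def)
  ultimately show ?case
    by (intro exI4[of _ s' y f 0]) auto
next
  case (Pop r)
  define s' where "s' = s(r := tl (s r))"
  have "runs {} (simulate v (Pop r)) (sim_store s y z f) (sim_store s' y z f)
      (weight (Pop r) * (1 + 0) * ask_cost (M + L + length z))"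
    unfolding simulate.simps s'_def by (rule runs_weaken[OF runs_Pop]) (auto simp: ask_cost_def)
  moreover have "length (s' i) \<le> m + 1" for i
    using Pop(1)[of i] Pop(1)[of r] by (auto simp: s'_def)
  ultimately show ?case
    by (intro exI4[of _ s' y f 0]) auto
next
  case (Query r)
  obtain a y' f' where res: "respond (s r) y z f = (a, y', f')" by (metis prod_cases3)
  have "ask_cost (length (s r) + length y + length z) \<le> ask_cost (M + L + length z)"
    using Query(1)[of r] Query(2,3) by (intro ask_cost_mono) simp
  also have "\<dots> \<le> weight (Query r) * (1 + (length y - length y')) * ask_cost (M + L + length z)"
    by simp
  finally have le: "ask_cost (length (s r) + length y + length z)
    \<le> weight (Query r) * (1 + (length y - length y')) * ask_cost (M + L + length z)" .
  define s' where "s' = s(r := [a])"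
  have "runs {} (simulate v (Query r)) (sim_store s y z f) (sim_store s' y' z f')
      (weight (Query r) * (1 + (length y - length y')) * ask_cost (M + L + length z))"
    unfolding s'_def by (rule runs_weaken[OF runs_ask[of s r, OF res] refl le])
  moreover have "length (s' i) \<le> m + weight (Query r) * (1 + (length y - length y'))" for i
    using Query(1)[of i] by (auto simp: s'_def intro: trans_le_add1)
  ultimately show ?case
    using length_respond[OF res] respond_flag[OF res]
    by (intro exI4[of _ s' y' f' "length y - length y'"])
      (auto simp del: simulate.simps weight.simps)
next
  case (Seq c d)
  let ?B = "ask_cost (M + L + length z)"
  obtain s1 y1 f1 d1 where 1: "runs {} (simulate v c) (sim_store s y z f) (sim_store s1 y1 z f1) (weight c * (1 + d1) * ?B)"
    "length y = length y1 + d1" "\<And>r. length (s1 r) \<le> m + weight c * (1 + d1)" "f \<noteq> [] \<Longrightarrow> f1 \<noteq> []"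
    using Seq.IH(1)[where s = s and m = m and y = y and f = f, OF Seq.prems(1,2)] Seq.prems(3) by (auto simp: algebra_simps)
  have "length y1 \<le> L" "m + weight c * (1 + d1) + weight d * (1 + length y1) \<le> M"
    using 1(2) Seq.prems(2,3) by (auto simp: algebra_simps)
  from Seq.IH(2)[where s = s1 and m = "m + weight c * (1 + d1)" and y = y1 and f = f1, OF 1(3) this]
  obtain s2 y2 f2 d2 where 2: "runs {} (simulate v d) (sim_store s1 y1 z f1) (sim_store s2 y2 z f2) (weight d * (1 + d2) * ?B)"
    "length y1 = length y2 + d2" "\<And>r. length (s2 r) \<le> m + weight c * (1 + d1) + weight d * (1 + d2)" "f1 \<noteq> [] \<Longrightarrow> f2 \<noteq> []"
    by auto
  have le: "weight c * (1 + d1) + weight d * (1 + d2) \<le> weight (Seq c d) * (1 + (d1 + d2))"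
    by (simp add: algebra_simps)
  have "weight c * (1 + d1) * ?B + weight d * (1 + d2) * ?B \<le> weight (Seq c d) * (1 + (d1 + d2)) * ?B"
    using mult_le_mono1[OF le, of ?B] by (simp add: algebra_simps)
  then have "runs {} (simulate v (Seq c d)) (sim_store s y z f) (sim_store s2 y2 z f2) (weight (Seq c d) * (1 + (d1 + d2)) * ?B)"
    unfolding simulate.simps by (rule runs_weaken[OF runs_Seq[OF 1(1) 2(1)] refl])
  moreover have "length (s2 r) \<le> m + weight (Seq c d) * (1 + (d1 + d2))" for r
    using 2(3)[of r] le by linarith
  ultimately show ?case using 1(2,4) 2(2,4)
    by (intro exI4[of _ s2 y2 f2 "d1 + d2"]) auto
next
  case (If b c d)
  let ?B = "ask_cost (M + L + length z)"
  let ?e = "if holds b s then c else d"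
  have "\<exists>s' y' f' d. runs {} (simulate v ?e) (sim_store s y z f) (sim_store s' y' z f')
      (weight ?e * (1 + d) * ?B) \<and>
    length y = length y' + d \<and> (\<forall>r. length (s' r) \<le> m + weight ?e * (1 + d)) \<and> (f \<noteq> [] \<longrightarrow> f' \<noteq> [])"
    using If.IH(1)[where s = s and m = m and y = y and f = f, OF If.prems(1,2)]
      If.IH(2)[where s = s and m = m and y = y and f = f, OF If.prems(1,2)] If.prems(3) by (auto simp: algebra_simps)
  then obtain s1 y1 f1 d1 where 1: "runs {} (simulate v ?e) (sim_store s y z f) (sim_store s1 y1 z f1) (weight ?e * (1 + d1) * ?B)"
    "length y = length y1 + d1" "\<And>r. length (s1 r) \<le> m + weight ?e * (1 + d1)" "f \<noteq> [] \<Longrightarrow> f1 \<noteq> []"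
    by auto
  have le: "weight ?e * (1 + d1) + 1 \<le> weight (If b c d) * (1 + d1)"
    by (simp add: algebra_simps)
  have "1 \<le> ?B" by (simp add: ask_cost_def)
  then have le': "Suc (weight ?e * (1 + d1) * ?B) \<le> weight (If b c d) * (1 + d1) * ?B"
    using mult_le_mono1[OF le, of ?B] by (simp add: algebra_simps)
  have "runs {} (simulate v (If b c d)) (sim_store s y z f) (sim_store s1 y1 z f1) (Suc (weight ?e * (1 + d1) * ?B))"
    unfolding simulate.simps by (rule runs_If) (use 1(1) in auto)
  then have "runs {} (simulate v (If b c d)) (sim_store s y z f) (sim_store s1 y1 z f1) (weight (If b c d) * (1 + d1) * ?B)"
    using le' by (rule runs_weaken[OF _ refl])
  moreover have "length (s1 r) \<le> m + weight (If b c d) * (1 + d1)" for r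
    using 1(3)[of r] le by linarith
  ultimately show ?case using 1(2,4)
    by (intro exI4[of _ s1 y1 f1 d1]) auto
next
  case (While b c)
  let ?B = "ask_cost (M + L + length z)" and ?W = "weight (While b c)"
  have B: "1 \<le> ?B" by (simp add: ask_cost_def)
  have W5: "5 \<le> ?W * ?B" using mult_le_mono[of 5 ?W 1 ?B] B by simp
  \<comment> \<open>Induction on the length of the transcript: the tick alone makes it shorter in
    every iteration.\<close>
  show ?case using While.prems
  proof (induction y arbitrary: s f m rule: length_induct)
    case (1 y)
    show ?case
    proof (cases "holds b s")
      case False
      show ?thesis
        by (intro exI4[of _ s y f 0], intro conjI
            runs_weaken[OF runs_simulate_While_exit[OF False] refl])
          (use W5 1(2) in \<open>auto simp del: weight.simps intro: trans_le_add1\<close>)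
    next
      case True
      show ?thesis
      proof (cases y)
        case Nil
        show ?thesis unfolding Nil
          by (intro exI4[of _ s "[]" "True # f" 0], intro conjI
              runs_weaken[OF runs_simulate_While_fail[OF True] refl])
            (use W5 1(2) in \<open>auto simp del: weight.simps intro: trans_le_add1\<close>)
      next
        case (Cons e y0)
        have "length y0 \<le> L" "m + weight c * (1 + length y0) \<le> M"
          using 1(3,4) by (auto simp: Cons algebra_simps)
        from While.IH[where s = s and m = m and y = y0 and f = f, OF 1(2) this]
        obtain s1 y1 f1 d1 where a: "runs {} (simulate v c) (sim_store s y0 z f) (sim_store s1 y1 z f1) (weight c * (1 + d1) * ?B)"
          "length y0 = length y1 + d1" "\<And>r. length (s1 r) \<le> m + weight c * (1 + d1)" "f \<noteq> [] \<Longrightarrow> f1 \<noteq> []"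
          by auto
        have "length y1 < length y" "length y1 \<le> L" "m + weight c * (1 + d1) + ?W * (1 + length y1) \<le> M"
          using a(2) 1(3,4) by (auto simp: Cons algebra_simps)
        with 1(1) a(3)
        obtain s2 y2 f2 d2 where b: "runs {} (simulate v (While b c)) (sim_store s1 y1 z f1) (sim_store s2 y2 z f2) (?W * (1 + d2) * ?B)"
          "length y1 = length y2 + d2" "\<And>r. length (s2 r) \<le> m + weight c * (1 + d1) + ?W * (1 + d2)" "f1 \<noteq> [] \<Longrightarrow> f2 \<noteq> []"
          by blast
        \<comment> \<open>The bit taken by the tick contributes one more \<open>?W\<close>, that is
          \<open>weight c + 6\<close>: it covers the body's share independent of \<open>d1\<close>
          and the overhead 6.\<close>
        have le: "weight c * (1 + d1) + ?W * (1 + d2) + 6 \<le> ?W * (1 + (1 + d1 + d2))"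
          by (simp add: algebra_simps)
        have "weight c * (1 + d1) * ?B + ?W * (1 + d2) * ?B + 6 \<le> (weight c * (1 + d1) + ?W * (1 + d2) + 6) * ?B"
          using B by (simp add: add_mult_distrib)
        also have "\<dots> \<le> ?W * (1 + (1 + d1 + d2)) * ?B"
          by (rule mult_le_mono1[OF le])
        finally have "runs {} (simulate v (While b c)) (sim_store s y z f) (sim_store s2 y2 z f2) (?W * (1 + (1 + d1 + d2)) * ?B)"
          unfolding Cons by (rule runs_weaken[OF runs_simulate_While_step[OF True a(1) b(1)] refl])
        moreover have "length (s2 r) \<le> m + ?W * (1 + (1 + d1 + d2))" for r
          using b(3)[of r] le by linarith
        ultimately show ?thesis using a(2,4) b(2,4) Cons
          by (intro exI4[of _ s2 y2 f2 "1 + d1 + d2"]) auto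
      qed
    qed
  qed
qed

lemma simulate_terminates:
  assumes "\<And>r. length (s r) \<le> m"
  obtains s' y' f' T m' where "runs {} (simulate v c) (sim_store s y z f) (sim_store s' y' z f') T"
    "f \<noteq> [] \<Longrightarrow> f' \<noteq> []" "\<And>r. length (s' r) \<le> m'"
  using simulate_total[where s = s and m = m and y = y and L = "length y" and c = c and z = z and f = f,
    OF assms order_refl order_refl] that by blast

text \<open>This is the honest transcript. A positive answer takes one bit plus the coded witness,
  two bits per bit and an end mark; every other step takes at most one bit. \<open>U\<close> bounds
  the queries. Leaving \<open>y'\<close> unread lets transcripts be concatenated, and no
  \<open>z\<close> adds a mark to \<open>f\<close>.\<close>

lemma simulate_complete:
  assumes "exec A c s t s'" "\<And>r. length (s r) \<le> m" "m + t \<le> U"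
    and A: "\<And>x. x \<in> A \<longleftrightarrow> (\<exists>w. V x w)" and V: "\<And>x w. V x w \<Longrightarrow> length w \<le> poly p (length x)"
  shows "\<exists>y. length y \<le> t * (2 * poly p U + 2) \<and>
    (\<forall>y' z f. \<exists>T. runs {} (simulate v c) (sim_store s (y @ y') z f) (sim_store s' y' z f) T)"
  using assms(1-3)
proof (induction arbitrary: m rule: exec.induct)
  case (Skip s)
  show ?case by (intro exI[of _ "[]"]) (auto intro: exI[of _ 1] runs_Skip)
next
  case (Push r b s)
  have *: "\<exists>T. runs {} (simulate v (Push r b)) (sim_store s ([] @ y') z f) (sim_store (s(r := b # s r)) y' z f) T" for y' z f
    unfolding simulate.simps by (intro exI[of _ 1], rule runs_weaken[OF runs_Push]) auto
  show ?case by (intro exI[of _ "[]"] conjI allI) (simp, rule *)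
next
  case (Pop r s)
  have *: "\<exists>T. runs {} (simulate v (Pop r)) (sim_store s ([] @ y') z f) (sim_store (s(r := tl (s r))) y' z f) T" for y' z f
    unfolding simulate.simps by (intro exI[of _ 1], rule runs_weaken[OF runs_Pop]) auto
  show ?case by (intro exI[of _ "[]"] conjI allI) (simp, rule *)
next
  case (Query r s)
  show ?case
  proof (cases "s r \<in> A")
    case True
    then obtain w where w: "V (s r) w" using A by auto
    have "length w \<le> poly p U"
      using V[OF w] Query(1)[of r] Query(2) poly_nat_mono[of "length (s r)" U p] by linarith
    moreover have "respond (s r) ((True # pair w []) @ y') z f = (s r \<in> A, y', f)" for y' z f
      using w True by (simp add: encode_append)
    then have *: "\<exists>T. runs {} (simulate v (Query r)) (sim_store s ((True # pair w []) @ y') z f) (sim_store (s(r := [s r \<in> A])) y' z f) T" for y' z f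
      using runs_ask by blast
    ultimately show ?thesis
      by (intro exI[of _ "True # pair w []"] conjI allI) (simp, rule *)
  next
    case False
    then have "respond (s r) ([False] @ y') z f = (s r \<in> A, y', f)" for y' z f
      using A by simp
    then have *: "\<exists>T. runs {} (simulate v (Query r)) (sim_store s ([False] @ y') z f) (sim_store (s(r := [s r \<in> A])) y' z f) T" for y' z f
      using runs_ask by blast
    show ?thesis by (intro exI[of _ "[False]"] conjI allI) (simp, rule *)
  qed
next
  case (Seq c s t s1 d t' s2)
  let ?K = "2 * poly p U + 2"
  have m: "length (s1 r) \<le> m + t" for r
    using exec_length[OF Seq.hyps(1), of r] Seq.prems(1)[of r] by linarith
  obtain y1 where y1: "length y1 \<le> t * ?K"
    "\<And>y' z f. \<exists>T. runs {} (simulate v c) (sim_store s (y1 @ y') z f) (sim_store s1 y' z f) T"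
    using Seq.IH(1)[of m] Seq.prems by auto
  obtain y2 where y2: "length y2 \<le> t' * ?K"
    "\<And>y' z f. \<exists>T. runs {} (simulate v d) (sim_store s1 (y2 @ y') z f) (sim_store s2 y' z f) T"
    using Seq.IH(2)[of "m + t"] m Seq.prems(2) by auto
  have "\<exists>T. runs {} (simulate v (Seq c d)) (sim_store s ((y1 @ y2) @ y') z f) (sim_store s2 y' z f) T" for y' z f
    using y1(2)[of "y2 @ y'" z f] y2(2)[of y' z f] by (auto intro: runs_Seq)
  then show ?case using y1(1) y2(1)
    by (intro exI[of _ "y1 @ y2"] conjI allI) (auto simp: add_mult_distrib)
next
  case (IfTrue b s c t s1 d)
  then obtain y where y: "length y \<le> t * (2 * poly p U + 2)"
    "\<And>y' z f. \<exists>T. runs {} (simulate v c) (sim_store s (y @ y') z f) (sim_store s1 y' z f) T"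
    using IfTrue.IH[of m] by auto
  have "\<exists>T. runs {} (simulate v (If b c d)) (sim_store s (y @ y') z f) (sim_store s1 y' z f) T" for y' z f
    using y(2)[of y' z f] IfTrue(1) runs_simulate_If[of "{}" v b s c d] by metis
  then show ?case using y(1) by (intro exI[of _ y] conjI allI) auto
next
  case (IfFalse b s d t s1 c)
  then obtain y where y: "length y \<le> t * (2 * poly p U + 2)"
    "\<And>y' z f. \<exists>T. runs {} (simulate v d) (sim_store s (y @ y') z f) (sim_store s1 y' z f) T"
    using IfFalse.IH[of m] by auto
  have "\<exists>T. runs {} (simulate v (If b c d)) (sim_store s (y @ y') z f) (sim_store s1 y' z f) T" for y' z f
    using y(2)[of y' z f] IfFalse(1) runs_simulate_If[of "{}" v b s c d] by metis
  then show ?case using y(1) by (intro exI[of _ y] conjI allI) auto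
next
  case (WhileFalse b s c)
  then show ?case
    by (intro exI[of _ "[]"] conjI allI) (auto intro: runs_simulate_While_exit[simplified])
next
  case (WhileTrue b s c t s1 t' s2)
  let ?K = "2 * poly p U + 2"
  have m: "length (s1 r) \<le> m + t" for r
    using exec_length[OF WhileTrue.hyps(2), of r] WhileTrue.prems(1)[of r] by linarith
  obtain y1 where y1: "length y1 \<le> t * ?K"
    "\<And>y' z f. \<exists>T. runs {} (simulate v c) (sim_store s (y1 @ y') z f) (sim_store s1 y' z f) T"
    using WhileTrue.IH(1)[of m] WhileTrue.prems by auto
  obtain y2 where y2: "length y2 \<le> t' * ?K"
    "\<And>y' z f. \<exists>T. runs {} (simulate v (While b c)) (sim_store s1 (y2 @ y') z f) (sim_store s2 y' z f) T"
    using WhileTrue.IH(2)[of "m + t"] m WhileTrue.prems(2) by auto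
  have "\<exists>T. runs {} (simulate v (While b c)) (sim_store s ((True # y1 @ y2) @ y') z f) (sim_store s2 y' z f) T" for y' z f
    using y1(2)[of "y2 @ y'" z f] y2(2)[of y' z f] runs_simulate_While_step[OF WhileTrue(1)]
    by (simp del: simulate.simps) blast
  then show ?case using y1(1) y2(1)
    by (intro exI[of _ "True # y1 @ y2"] conjI allI) (auto simp del: simulate.simps simp: add_mult_distrib)
qed

text \<open>
  In the second alternative, \<open>z\<close> is a witness for the first query that the transcript wrongly
  answers negatively (or arbitrary, if the transcript is already inconsistent by itself).
\<close>

lemma simulate_sound:
  assumes "exec A c s t s'" "\<And>r. length (s r) \<le> m" "m + t \<le> U"
    and A: "\<And>x. x \<in> A \<longleftrightarrow> (\<exists>w. V x w)" and V: "\<And>x w. V x w \<Longrightarrow> length w \<le> poly p (length x)"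
  shows "(\<exists>y'. \<forall>z f. \<exists>T f'. runs {} (simulate v c) (sim_store s y z f) (sim_store s' y' z f') T) \<or>
    (\<exists>z. length z \<le> poly p U \<and> (\<forall>f. \<exists>T s'' y'' f'' m''.
      runs {} (simulate v c) (sim_store s y z f) (sim_store s'' y'' z f'') T \<and> f'' \<noteq> [] \<and>
      (\<forall>r. length (s'' r) \<le> m'')))"
    (is "?good c s y s' \<or> ?bad c s y")
  using assms(1-3)
proof (induction arbitrary: m y rule: exec.induct)
  case (Skip s)
  show ?case by (auto intro: exI[of _ 1] runs_Skip)
next
  case (Push r b s)
  have "runs {} (simulate v (Push r b)) (sim_store s y z f) (sim_store (s(r := b # s r)) y z f) 1" for z f
    unfolding simulate.simps by (rule runs_weaken[OF runs_Push]) auto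
  then show ?case by blast
next
  case (Pop r s)
  have "runs {} (simulate v (Pop r)) (sim_store s y z f) (sim_store (s(r := tl (s r))) y z f) 1" for z f
    unfolding simulate.simps by (rule runs_weaken[OF runs_Pop]) auto
  then show ?case by blast
next
  case (Query r s)
  have bnd: "length ((s(r := [a])) i) \<le> m + 1" for a i
    using Query(1)[of i] by auto
  have bad: "?bad (Query r) s y"
    if "length z \<le> poly p U" "\<And>f. snd (snd (respond (s r) y z f)) \<noteq> []" for z
  proof -
    have "\<exists>T s'' y'' f'' m''. runs {} (simulate v (Query r)) (sim_store s y z f) (sim_store s'' y'' z f'') T \<and> f'' \<noteq> [] \<and>
      (\<forall>r. length (s'' r) \<le> m'')" for f
    proof -
      obtain a y' f' where res: "respond (s r) y z f = (a, y', f')" by (metis prod_cases3)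
      then show ?thesis using runs_ask[of s r, OF res] that(2)[of f] bnd by (metis snd_conv)
    qed
    then show ?thesis using that(1) by blast
  qed
  have good: "?good (Query r) s y (s(r := [s r \<in> A]))"
    if "\<And>z f. fst (respond (s r) y z f) = (s r \<in> A) \<and> fst (snd (respond (s r) y z f)) = y'" for y'
  proof -
    have "respond (s r) y z f = (s r \<in> A, y', snd (snd (respond (s r) y z f)))" for z f
      using that[of z f] by (simp add: prod_eq_iff)
    then show ?thesis using runs_ask[of s r] by blast
  qed
  show ?case
  proof (cases "\<exists>e. y = True # e")
    case True
    then obtain e where y: "y = True # e" by auto
    \<comment> \<open>A positive answer cannot be wrong unnoticed: its witness is accepted and
      proves it, or a mark is set whatever \<open>z\<close> is.\<close>
    show ?thesis
    proof (cases "V (s r) (fst (decode [] e))")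
      case True
      then show ?thesis using y A by (intro disjI1 good[of "snd (decode [] e)"]) auto
    next
      case False
      then show ?thesis using y by (intro disjI2 bad[of "[]"]) auto
    qed
  next
    case False
    then have y: "respond (s r) y z f = (False, tl y, if V (s r) z then True # f else f)" for z f
      by (cases "(s r, y, z, f)" rule: respond.cases) auto
    show ?thesis
    proof (cases "s r \<in> A")
      case True
      then obtain w where w: "V (s r) w" using A by auto
      have "length w \<le> poly p U"
        using V[OF w] Query(1)[of r] Query(2) poly_nat_mono[of "length (s r)" U p] by linarith
      then show ?thesis using w by (intro disjI2 bad[of w]) (auto simp: y)
    next
      case False
      then show ?thesis by (intro disjI1 good[of "tl y"]) (auto simp: y)
    qed
  qed
next
  case (Seq c s t s1 d t' s2)
  have m: "length (s1 r) \<le> m + t" for r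
    using exec_length[OF Seq.hyps(1), of r] Seq.prems(1)[of r] by linarith
  have "?good c s y s1 \<or> ?bad c s y"
    by (rule Seq.IH(1)[of m]) (use Seq.prems in auto)
  then consider "?good c s y s1" | "?bad c s y" by blast
  then show ?case
  proof cases
    case 1
    then obtain y1 where y1: "\<And>z f. \<exists>T f'. runs {} (simulate v c) (sim_store s y z f) (sim_store s1 y1 z f') T"
      by blast
    \<comment> \<open>The first part reaches the true store for every \<open>z\<close>, so the
      choice of \<open>z\<close> is left to the second part.\<close>
    have "?good d s1 y1 s2 \<or> ?bad d s1 y1"
      by (rule Seq.IH(2)[of "m + t"]) (use m Seq.prems(2) in auto)
    then consider "?good d s1 y1 s2" | "?bad d s1 y1" by blast
    then show ?thesis
    proof cases
      case 1
      then show ?thesis using y1 unfolding simulate.simps by (meson runs_Seq)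
    next
      case 2
      then show ?thesis using y1 unfolding simulate.simps by (meson runs_Seq)
    qed
  next
    \<comment> \<open>The simulation may have left the true run, beyond the reach of the induction
      hypothesis for \<open>d\<close>. It suffices that the rest halts and keeps the mark; the bound
      \<open>m''\<close> feeds \<open>simulate_terminates\<close>.\<close>
    case 2
    then obtain z where z: "length z \<le> poly p U" and run: "\<And>f. \<exists>T s'' y'' f'' m''.
      runs {} (simulate v c) (sim_store s y z f) (sim_store s'' y'' z f'') T \<and> f'' \<noteq> [] \<and>
      (\<forall>r. length (s'' r) \<le> m'')" by blast
    have "\<exists>T s'' y'' f'' m''.
      runs {} (simulate v (Seq c d)) (sim_store s y z f) (sim_store s'' y'' z f'') T \<and> f'' \<noteq> [] \<and>
      (\<forall>r. length (s'' r) \<le> m'')" for f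
    proof -
      obtain T s'' y'' f'' m'' where 1: "runs {} (simulate v c) (sim_store s y z f) (sim_store s'' y'' z f'') T"
        "f'' \<noteq> []" "\<And>r. length (s'' r) \<le> m''" using run by blast
      obtain s3 y3 f3 T3 m3 where 2: "runs {} (simulate v d) (sim_store s'' y'' z f'') (sim_store s3 y3 z f3) T3"
        "f'' \<noteq> [] \<Longrightarrow> f3 \<noteq> []" "\<And>r. length (s3 r) \<le> m3"
        using simulate_terminates[where s = s'' and m = m'' and c = d and y = y'' and z = z and f = f'', OF 1(3)] by metis
      show ?thesis using runs_Seq[OF 1(1) 2(1)] 1(2) 2(2,3) unfolding simulate.simps by blast
    qed
    then show ?thesis using z by blast
  qed
next
  case (IfTrue b s c t s1 d)
  have *: "runs {} (simulate v (If b c d)) (sim_store s y z f) \<sigma> (Suc T)"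
    if "runs {} (simulate v c) (sim_store s y z f) \<sigma> T" for z f \<sigma> T
    using that IfTrue(1) by (intro runs_simulate_If) simp
  have "?good c s y s1 \<or> ?bad c s y"
    by (rule IfTrue.IH[of m]) (use IfTrue.prems in auto)
  then show ?case using * by meson
next
  case (IfFalse b s d t s1 c)
  have *: "runs {} (simulate v (If b c d)) (sim_store s y z f) \<sigma> (Suc T)"
    if "runs {} (simulate v d) (sim_store s y z f) \<sigma> T" for z f \<sigma> T
    using that IfFalse(1) by (intro runs_simulate_If) simp
  have "?good d s y s1 \<or> ?bad d s y"
    by (rule IfFalse.IH[of m]) (use IfFalse.prems in auto)
  then show ?case using * by meson
next
  case (WhileFalse b s c)
  then show ?case using runs_simulate_While_exit by blast
next
  case (WhileTrue b s c t s1 t' s2)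
  have m: "length (s1 r) \<le> m + t" for r
    using exec_length[OF WhileTrue.hyps(2), of r] WhileTrue.prems(1)[of r] by linarith
  show ?case
  proof (cases y)
    case Nil
    \<comment> \<open>No bit is left to pay for an iteration that the true run performs, so any
      \<open>z\<close> refutes.\<close>
    have "?bad (While b c) s y" unfolding Nil
      by (intro exI[of _ "[]"] conjI allI, simp)
         (use runs_simulate_While_fail[OF WhileTrue(1)] WhileTrue.prems(1) in blast)
    then show ?thesis by blast
  next
    case (Cons e y0)
    note step = runs_simulate_While_step[where e = e, OF WhileTrue(1)]
    have "?good c s y0 s1 \<or> ?bad c s y0"
      by (rule WhileTrue.IH(1)[of m]) (use WhileTrue.prems in auto)
    then consider "?good c s y0 s1" | "?bad c s y0" by blast
    then show ?thesis unfolding Cons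
    proof cases
      case 1
      then obtain y1 where y1: "\<And>z f. \<exists>T f'. runs {} (simulate v c) (sim_store s y0 z f) (sim_store s1 y1 z f') T"
        by blast
      have "?good (While b c) s1 y1 s2 \<or> ?bad (While b c) s1 y1"
        by (rule WhileTrue.IH(2)[of "m + t"]) (use m WhileTrue.prems(2) in auto)
      then consider "?good (While b c) s1 y1 s2" | "?bad (While b c) s1 y1" by blast
      then show "?good (While b c) s (e # y0) s2 \<or> ?bad (While b c) s (e # y0)"
      proof cases
        case 1
        then show ?thesis using y1 by (meson step)
      next
        case 2
        then show ?thesis using y1 by (meson step)
      qed
    next
      case 2
      then obtain z where z: "length z \<le> poly p U" and run: "\<And>f. \<exists>T s'' y'' f'' m''.
        runs {} (simulate v c) (sim_store s y0 z f) (sim_store s'' y'' z f'') T \<and> f'' \<noteq> [] \<and>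
        (\<forall>r. length (s'' r) \<le> m'')" by blast
      have "\<exists>T s'' y'' f'' m''.
        runs {} (simulate v (While b c)) (sim_store s (e # y0) z f) (sim_store s'' y'' z f'') T \<and> f'' \<noteq> [] \<and>
        (\<forall>r. length (s'' r) \<le> m'')" for f
      proof -
        obtain T s'' y'' f'' m'' where 1: "runs {} (simulate v c) (sim_store s y0 z f) (sim_store s'' y'' z f'') T"
          "f'' \<noteq> []" "\<And>r. length (s'' r) \<le> m''" using run by blast
        obtain s3 y3 f3 T3 m3 where 2: "runs {} (simulate v (While b c)) (sim_store s'' y'' z f'') (sim_store s3 y3 z f3) T3"
          "f'' \<noteq> [] \<Longrightarrow> f3 \<noteq> []" "\<And>r. length (s3 r) \<le> m3"
          using simulate_terminates[where s = s'' and m = m'' and c = "While b c" and y = y'' and z = z and f = f'', OF 1(3)] by metis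
        show ?thesis using step[OF 1(1) 2(1)] 1(2) 2(2,3) by blast
      qed
      then show "?good (While b c) s (e # y0) s2 \<or> ?bad (While b c) s (e # y0)" using z by blast
    qed
  qed
qed

end

section \<open>The game with moves of equal length\<close>

lemma (in query_verifier) transcript_game:
  assumes A: "\<And>x. x \<in> A \<longleftrightarrow> (\<exists>w. V x w)" and V: "\<And>x w. V x w \<Longrightarrow> length w \<le> poly p (length x)"
    and c: "computes_polytime A c 2 (\<lambda>xs. [R (xs ! 0) (xs ! 1)])"
    and total: "\<And>x. \<exists>w. R x w" and pR: "\<And>x w. R x w \<Longrightarrow> length w \<le> poly pR (length x)"
  obtains Q q where "polytime_pred3 Q"
    "\<And>x. \<exists>y. length y = poly q (length x) \<and> (\<forall>z. length z = poly q (length x) \<longrightarrow> Q x y z)"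
    "\<And>x y. length y = poly q (length x) \<Longrightarrow> \<forall>z. length z = poly q (length x) \<longrightarrow> Q x y z \<Longrightarrow>
      R x (fst (decode [] y))"
proof -
  obtain pc where pc: "\<And>xs. length xs = 2 \<Longrightarrow> \<exists>t s. exec A c (input xs) t s \<and>
      s 0 = [R (xs ! 0) (xs ! 1)] \<and> t \<le> poly pc (sum_list (map length xs))"
    using c unfolding computes_polytime_def by blast
  obtain cl T where cl: "oracle_free cl" "poly_bounded T" and
    run_cl: "\<And>B s. s 10 = [] \<Longrightarrow> s 13 = [] \<Longrightarrow> s 16 = [] \<Longrightarrow> s 19 = [] \<Longrightarrow>
      runs B cl s (s(10 := replicate (poly pR (length (s 0)) - length (s 3)) True,
        7 := replicate (length (s 3) - poly pR (length (s 0))) True @ s 7))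
      (T (length (s 0) + length (s 3)))"
    using length_comparison_program[of 0 3 10 7 13 16 19 pR] by auto
  obtain pT where pT: "\<And>n. T n \<le> poly pT n" using cl(2) unfolding poly_bounded_def by auto
  define reply where "reply b = Seq (clear 0) (Push 0 b)" for b
  define verdict where "verdict = If (NonEmpty 7) (reply False) (If (TopOne 0) (reply True) (reply False))"
  \<comment> \<open>The second move is decoded too, so that a short witness can be padded to the
    prescribed length. Register 3 is register 1 of the simulated program, which thus finds
    \<open>x\<close> and the claimed solution as its arguments.\<close>
  define prelude where "prelude = Seq (decode_program 2 4) (Seq (clear 2) (Seq (decode_program 1 3) (Seq cl (clear 10))))"
  define P where "P = Seq prelude (Seq (simulate v c) verdict)"
  \<comment> \<open>By determinism, any one run of \<open>P\<close> settles the value of this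
    predicate.\<close>
  define Q where "Q x y z \<longleftrightarrow> (\<exists>T s. runs {} P (input [x, y, z]) s T \<and> s 0 = [True])" for x y z
  \<comment> \<open>As initial content of register 7 this makes an overlong claim lose from the
    start.\<close>
  define flag where "flag x w = replicate (length w - poly pR (length x)) True" for x w :: bits
  define start where "start x y z f = sim_store (input [x, fst (decode [] y)]) (snd (decode [] y)) z f" for x y z f
  define E where "E n = 20 * n + 20 + poly pT n + 2 * poly pR n" for n

  have prelude: "runs {} prelude (input [x, y, z])
      (start x y (fst (decode [] z)) (flag x (fst (decode [] y)))) (E (length x + length y + length z))" for x y z
  proof -
    let ?n = "length x + length y + length z"
    let ?z = "fst (decode [] z)" and ?w = "fst (decode [] y)"
    let ?s1 = "(input [x, y])(4 := ?z, 2 := snd (decode [] z))" and ?s2 = "(input [x, y])(4 := ?z)"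
    let ?s3 = "start x y ?z []"
    let ?s4 = "start x y ?z (flag x ?w)"
    let ?k = "replicate (poly pR (length x) - length ?w) True"
    have 1: "runs {} (decode_program 2 4) (input [x, y, z]) ?s1 (5 * length z + 7)"
      by (rule runs_weaken[OF runs_decode])
         (auto simp: input_def fun_eq_iff less_Suc_eq numeral_2_eq_2 numeral_3_eq_3)
    have 2: "runs {} (clear 2) ?s1 ?s2 (2 * length z + 1)"
      using length_decode[of "[]" z]
      by (intro runs_weaken[OF runs_clear]) (auto simp: input_def fun_eq_iff)
    have ds: "?s2(Suc 0 := snd (decode [] y), 3 := ?w) = ?s3"
      unfolding start_def sim_store_def fun_eq_iff
    proof
      fix r :: nat
      consider "r < 8" | "r \<ge> 8" by linarith
      then show "(?s2(Suc 0 := snd (decode [] y), 3 := ?w)) r =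
        (if r mod 3 = 0 then input [x, ?w] (r div 3) else if r = 1 then snd (decode [] y)
         else if r = 4 then ?z else if r = 7 then [] else [])"
      proof cases
        case 1
        then have "r \<in> {0, 1, 2, 3, 4, 5, 6, 7}" by auto
        then show ?thesis by (auto simp: input_def)
      next
        case 2
        then have "r div 3 \<ge> 2" by linarith
        with 2 show ?thesis by (auto simp: input_def)
      qed
    qed
    have 3: "runs {} (decode_program 1 3) ?s2 ?s3 (5 * length y + 7)"
      by (rule runs_weaken[OF runs_decode]) (use ds in \<open>auto simp: input_def\<close>)
    have s: "?s3 3 = ?w" "?s3 0 = x" "?s3 10 = []" "?s3 13 = []" "?s3 16 = []" "?s3 19 = []" "?s3 7 = []"
      using sim_store_simps(1)[of _ _ _ _ 1] by (auto simp: start_def sim_store_def input_def)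
    have w: "length ?w \<le> length y" using length_decode[of "[]" y] by simp
    have "T (length x + length ?w) \<le> poly pT ?n"
      using w by (intro le_trans[OF pT] poly_nat_mono) simp
    then have 4: "runs {} cl ?s3 (?s4(10 := ?k)) (poly pT ?n)"
      using run_cl[of ?s3 "{}", unfolded s, OF refl refl refl refl]
      by (auto elim!: runs_weaken simp: flag_def start_def fun_upd_twist[of 10 7])
    have "poly pR (length x) \<le> poly pR ?n" by (intro poly_nat_mono) simp
    then have 5: "runs {} (clear 10) (?s4(10 := ?k)) ?s4 (2 * poly pR ?n + 1)"
      by (intro runs_weaken[OF runs_clear]) (auto simp: start_def)
    show ?thesis unfolding prelude_def
      by (rule runs_weaken[OF runs_Seq[OF 1 runs_Seq[OF 2 runs_Seq[OF 3 runs_Seq[OF 4 5]]]] refl])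
         (auto simp: E_def)
  qed
  have verdict: "\<exists>s'. runs {} verdict s s' (2 * length (s 0) + 4) \<and>
      s' 0 = [s 7 = [] \<and> holds (TopOne 0) s]" for s
  proof -
    have reply: "runs {} (reply b) s (s(0 := [b])) (2 * length (s 0) + 2)" for b
      unfolding reply_def by (rule runs_weaken[OF runs_Seq[OF runs_clear runs_Push]]) auto
    have "runs {} verdict s (s(0 := [s 7 = [] \<and> holds (TopOne 0) s])) (Suc (Suc (2 * length (s 0) + 2)))"
      unfolding verdict_def
    proof (rule runs_If)
      assume "holds (NonEmpty 7) s"
      then show "runs {} (reply False) s (s(0 := [s 7 = [] \<and> holds (TopOne 0) s])) (Suc (2 * length (s 0) + 2))"
        by (intro runs_weaken[OF reply]) auto
    next
      assume "\<not> holds (NonEmpty 7) s"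
      then show "runs {} (If (TopOne 0) (reply True) (reply False)) s
          (s(0 := [s 7 = [] \<and> holds (TopOne 0) s])) (Suc (2 * length (s 0) + 2))"
        by (intro runs_If runs_weaken[OF reply]) auto
    qed
    then have "runs {} verdict s (s(0 := [s 7 = [] \<and> holds (TopOne 0) s])) (2 * length (s 0) + 4)"
      by (rule runs_weaken) auto
    then show ?thesis by (intro exI[of _ "s(0 := [s 7 = [] \<and> holds (TopOne 0) s])"]) simp
  qed
  have P: "\<exists>s''. runs {} P (input [x, y, z]) s'' (E (length x + length y + length z) + (T' + (2 * length (s' 0) + 4))) \<and>
      s'' 0 = [f' = [] \<and> (\<exists>e. s' 0 = True # e)]"
    if sim: "runs {} (simulate v c) (start x y (fst (decode [] z)) (flag x (fst (decode [] y)))) (sim_store s' y' z' f') T'"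
    for x y z s' y' z' f' T'
  proof -
    obtain s'' where "runs {} verdict (sim_store s' y' z' f') s'' (2 * length (s' 0) + 4)"
      "s'' 0 = [f' = [] \<and> (\<exists>e. s' 0 = True # e)]"
      using verdict[of "sim_store s' y' z' f'"] by auto
    with runs_Seq[OF prelude runs_Seq[OF sim]] show ?thesis unfolding P_def by blast
  qed
  have Q: "Q x y z \<longleftrightarrow> f' = [] \<and> (\<exists>e. s' 0 = True # e)"
    if sim: "runs {} (simulate v c) (start x y (fst (decode [] z)) (flag x (fst (decode [] y)))) (sim_store s' y' z' f') T'"
    for x y z s' y' z' f' T'
  proof -
    obtain T s'' where run: "runs {} P (input [x, y, z]) s'' T"
      and s'': "s'' 0 = [f' = [] \<and> (\<exists>e. s' 0 = True # e)]"
      using P[OF sim] by blast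
    have "Q x y z \<longleftrightarrow> s'' 0 = [True]"
      using run runs_deterministic[OF run] unfolding Q_def by blast
    then show ?thesis unfolding s'' by simp
  qed

  have polytime_Q: "polytime_pred3 Q" unfolding polytime_pred3_def
  proof (rule polytimeI)
    \<comment> \<open>At most all transcript bits are consumed, so \<open>S\<close> bounds the
      registers at the end of the simulation and \<open>W\<close> its time.\<close>
    define S where "S n = n + weight c * (1 + n)" for n
    define W where "W n = weight c * (1 + n) * ask_cost (S n + n + n)" for n
    define T' where "T' n = E n + (W n + (2 * S n + 4))" for n
    show "oracle_free P"
      using cl(1) oracle_free_v oracle_free_simulate
      by (simp add: P_def prelude_def verdict_def reply_def)
    show "poly_bounded T'" unfolding T'_def W_def S_def E_def ask_cost_def
      by (intro poly_bounded_add poly_bounded_mult poly_bounded_const poly_bounded_id poly_bounded_poly)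
    fix xs :: "bits list" assume "length xs = 3"
    then obtain x y z where xs: "xs = [x, y, z]" by (auto simp: numeral_3_eq_3 length_Suc_conv)
    let ?n = "length x + length y + length z"
    let ?z = "fst (decode [] z)" and ?w = "fst (decode [] y)" and ?y = "snd (decode [] y)"
    have len: "length ?w + length ?y \<le> length y" "length ?z \<le> length z"
      using length_decode[of "[]" y] length_decode[of "[]" z] by auto
    have 1: "length (input [x, ?w] r) \<le> ?n" for r
      using length_input_le[of "[x, ?w]" r] len by simp
    have "weight c * (1 + length ?y) \<le> weight c * (1 + ?n)"
      using len by (intro mult_le_mono2) simp
    then have 2: "length ?y \<le> ?n" "?n + weight c * (1 + length ?y) \<le> S ?n"
      using len by (auto simp: S_def)
    obtain s' y' f' d where s': "runs {} (simulate v c) (start x y ?z (flag x ?w)) (sim_store s' y' ?z f')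
        (weight c * (1 + d) * ask_cost (S ?n + ?n + length ?z))"
      "length ?y = length y' + d" "length (s' 0) \<le> ?n + weight c * (1 + d)"
      using simulate_total[where s = "input [x, ?w]" and z = ?z and f = "flag x ?w", OF 1 2] unfolding start_def by blast
    have d: "weight c * (1 + d) \<le> weight c * (1 + ?n)"
      using s'(2) len by (intro mult_le_mono2) simp
    have "ask_cost (S ?n + ?n + length ?z) \<le> ask_cost (S ?n + ?n + ?n)"
      using len by (intro ask_cost_mono) simp
    then have W: "weight c * (1 + d) * ask_cost (S ?n + ?n + length ?z) \<le> W ?n"
      unfolding W_def by (rule mult_le_mono[OF d])
    have "length (s' 0) \<le> S ?n"
      using s'(3) d unfolding S_def by linarith
    then have le: "E ?n + (weight c * (1 + d) * ask_cost (S ?n + ?n + length ?z) + (2 * length (s' 0) + 4)) \<le> T' ?n"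
      using W unfolding T'_def by linarith
    obtain s'' where "runs {} P (input [x, y, z]) s'' (T' ?n)" "s'' 0 = [Q x y z]"
      using P[OF s'(1), folded Q[OF s'(1)]] runs_weaken[OF _ refl le] by blast
    then show "\<exists>s. runs {} P (input xs) s (T' (sum_list (map length xs))) \<and>
        s 0 = [Q (xs ! 0) (xs ! 1) (xs ! 2)]"
      by (auto simp: xs add.assoc numeral_2_eq_2)
  qed

  \<comment> \<open>Bounds all registers, hence all queries, in the true run on \<open>x\<close> and
    a claim of admissible length; it depends on the length of \<open>x\<close> alone.\<close>
  define U where "U n = n + poly pR n + poly pc (n + poly pR n)" for n
  \<comment> \<open>Room for either move: the coded solution, the honest transcript, and the coded
    witness of the second player, each code with one bit for its end mark.\<close>
  define b where "b n = 2 * poly pR n + 1 + poly pc (n + poly pR n) * (2 * poly p (U n) + 2)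
    + (2 * poly p (U n) + 1)" for n
  have "poly_bounded b" unfolding b_def U_def
    by (intro poly_bounded_add poly_bounded_mult poly_bounded_const poly_bounded_id poly_bounded_poly)
  then obtain q where q: "\<And>n. b n \<le> poly q n" unfolding poly_bounded_def by auto
  have run_c: "\<exists>t s. exec A c (input [x, w]) t s \<and> s 0 = [R x w] \<and>
      t \<le> poly pc (length x + poly pR (length x)) \<and> length x + length w + t \<le> U (length x)"
    if "length w \<le> poly pR (length x)" for x w
  proof -
    obtain t s where "exec A c (input [x, w]) t s" "s 0 = [R x w]" "t \<le> poly pc (length x + length w)"
      using pc[of "[x, w]"] by auto
    moreover have "poly pc (length x + length w) \<le> poly pc (length x + poly pR (length x))"
      using that by (intro poly_nat_mono) simp
    ultimately show ?thesis using that unfolding U_def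
      by (intro exI[of _ t] exI[of _ s]) auto
  qed
  have input_le: "length (input [x, w] r) \<le> length x + length w" for x w r
    using length_input_le[of "[x, w]" r] by simp

  show ?thesis
  proof (rule that[OF polytime_Q])
    fix x :: bits
    let ?n = "length x"
    obtain w where R: "R x w" using total by auto
    have w: "length w \<le> poly pR ?n" using pR[OF R] .
    then obtain t s where s: "exec A c (input [x, w]) t s" "s 0 = [R x w]"
      "t \<le> poly pc (?n + poly pR ?n)" "?n + length w + t \<le> U ?n"
      using run_c by blast
    obtain y where y: "length y \<le> t * (2 * poly p (U ?n) + 2)"
      "\<And>y' z f. \<exists>T. runs {} (simulate v c) (sim_store (input [x, w]) (y @ y') z f) (sim_store s y' z f) T"
      using simulate_complete[OF s(1) input_le s(4) A V] by blast
    have "t * (2 * poly p (U ?n) + 2) \<le> poly pc (?n + poly pR ?n) * (2 * poly p (U ?n) + 2)"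
      using s(3) by (rule mult_le_mono1)
    then have le: "length (pair w y) \<le> poly q ?n"
      using q[of ?n] w y(1) unfolding b_def by simp
    \<comment> \<open>The padding follows the honest transcript, where it is never read.\<close>
    let ?pad = "replicate (poly q ?n - length (pair w y)) False"
    have "Q x (pair w (y @ ?pad)) z" for z
    proof -
      obtain T where "runs {} (simulate v c) (sim_store (input [x, w]) (y @ ?pad) (fst (decode [] z)) [])
          (sim_store s ?pad (fst (decode [] z)) []) T"
        using y(2) by blast
      then have "runs {} (simulate v c) (start x (pair w (y @ ?pad)) (fst (decode [] z)) (flag x w))
          (sim_store s ?pad (fst (decode [] z)) []) T"
        using w by (simp add: start_def flag_def)
      then show ?thesis using Q[of x "pair w (y @ ?pad)" z] s(2) R by simp
    qed
    moreover have "length (pair w (y @ ?pad)) = poly q ?n" using le by simp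
    ultimately show "\<exists>y. length y = poly q ?n \<and> (\<forall>z. length z = poly q ?n \<longrightarrow> Q x y z)" by blast
  next
    fix x y :: bits
    let ?n = "length x" and ?w = "fst (decode [] y)" and ?y = "snd (decode [] y)"
    assume win: "\<forall>z. length z = poly q ?n \<longrightarrow> Q x y z"
    \<comment> \<open>An overlong claim starts with a mark that the halting simulation keeps, so
      every second move beats it.\<close>
    have w: "length ?w \<le> poly pR ?n"
    proof (rule ccontr)
      assume "\<not> length ?w \<le> poly pR ?n"
      then have "flag x ?w \<noteq> []" by (simp add: flag_def)
      moreover define z where "z = replicate (poly q ?n) False"
      obtain s' y' f' T m' where "runs {} (simulate v c) (start x y (fst (decode [] z)) (flag x ?w)) (sim_store s' y' (fst (decode [] z)) f') T"
        "flag x ?w \<noteq> [] \<Longrightarrow> f' \<noteq> []"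
        using simulate_terminates[where s = "input [x, ?w]" and c = c and y = ?y and z = "fst (decode [] z)" and f = "flag x ?w", OF input_le]
        unfolding start_def by metis
      ultimately have "\<not> Q x y z" using Q by blast
      then show False using win by (simp add: z_def)
    qed
    then have fl: "flag x ?w = []" by (simp add: flag_def)
    obtain t s where s: "exec A c (input [x, ?w]) t s" "s 0 = [R x ?w]" "?n + length ?w + t \<le> U ?n"
      using run_c[OF w] by blast
    show "R x ?w"
    proof (rule simulate_sound[where y = ?y, OF s(1) input_le s(3) A V, THEN disjE];
        (assumption | elim exE conjE))
      \<comment> \<open>The simulation ends in the true final store, so acceptance against a single
        \<open>z\<close> already gives \<open>R\<close>.\<close>
      fix y' assume *: "\<forall>z f. \<exists>T f'. runs {} (simulate v c) (sim_store (input [x, ?w]) ?y z f) (sim_store s y' z f') T"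
      define z where "z = replicate (poly q ?n) False"
      obtain T f' where "runs {} (simulate v c) (start x y (fst (decode [] z)) (flag x ?w)) (sim_store s y' (fst (decode [] z)) f') T"
        using * unfolding start_def by blast
      from Q[OF this] win s(2) show ?thesis by (auto simp: z_def)
    next
      fix z assume z: "length z \<le> poly p (U ?n)"
        and *: "\<forall>f. \<exists>T s'' y'' f'' m''. runs {} (simulate v c) (sim_store (input [x, ?w]) ?y z f) (sim_store s'' y'' z f'') T
          \<and> f'' \<noteq> [] \<and> (\<forall>r. length (s'' r) \<le> m'')"
      \<comment> \<open>The refuting string, coded and padded to a legal second move.\<close>
      define z' where "z' = pair z (replicate (poly q ?n - length (pair z [])) False)"
      have z': "length z' = poly q ?n" "fst (decode [] z') = z"
        using q[of ?n] z unfolding b_def z'_def by auto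
      obtain T s'' y'' f'' where "runs {} (simulate v c) (start x y (fst (decode [] z')) (flag x ?w)) (sim_store s'' y'' z f'') T" "f'' \<noteq> []"
        using * unfolding start_def z' by blast
      then show ?thesis using Q win z'(1) by blast
    qed
  qed
qed

lemma TFNP_NP_reduces_to_S2P_Search:
  assumes "TFNP_NP R"
  shows "\<exists>Q q. S2P_predicate Q q \<and> search_reduces R (S2P_Search Q q)"
proof -
  obtain A c pR where A: "A \<in> NP" and c: "computes_polytime A c 2 (\<lambda>xs. [R (xs ! 0) (xs ! 1)])"
    and total: "\<And>x. \<exists>w. R x w" and pR: "\<And>x w. R x w \<Longrightarrow> length w \<le> poly pR (length x)"
    using assms unfolding TFNP_NP_def P_NP_rel_def by blast
  obtain V p where V: "polytime_pred2 V" "\<And>x y. V x y \<Longrightarrow> length y \<le> poly p (length x)"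
    "\<And>x. x \<in> A \<longleftrightarrow> (\<exists>y. V x y)"
    using NP_verifier[OF A] by blast
  obtain v pV where v: "oracle_free v" and run_v: "\<And>xs B. length xs = 2 \<Longrightarrow>
      runs B v (input xs) (input [[V (xs ! 0) (xs ! 1)]]) (poly pV (sum_list (map length xs)))"
    using polytime_clean[OF V(1)[unfolded polytime_pred2_def]] by blast
  interpret query_verifier v V pV
  proof
    show "runs {} v (input [x, y]) (input [[V x y]]) (poly pV (length x + length y))" for x y
      using run_v[of "[x, y]" "{}"] by simp
  qed (rule v)
  obtain Q q where Q: "polytime_pred3 Q"
    and win: "\<And>x. \<exists>y. length y = poly q (length x) \<and> (\<forall>z. length z = poly q (length x) \<longrightarrow> Q x y z)"
    and sound: "\<And>x y. length y = poly q (length x) \<Longrightarrow> \<forall>z. length z = poly q (length x) \<longrightarrow> Q x y z \<Longrightarrow>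
      R x (fst (decode [] y))"
    using transcript_game[OF V(3,2) c total pR] by blast
  have "S2P_defines Q q UNIV"
    using Q win unfolding S2P_defines_def by blast
  then have "S2P_predicate Q q" unfolding S2P_predicate_def S2P_def by blast
  moreover have "search_reduces R (S2P_Search Q q)" unfolding search_reduces_def
  proof (intro exI conjI allI impI)
    show "polytime_fun1 (\<lambda>x. x)" unfolding polytime_fun1_def
    proof (rule polytimeI[where c = Skip and T = "\<lambda>n. 1"])
      fix xs :: "bits list" assume "length xs = 1"
      then show "\<exists>s. runs {} Skip (input xs) s 1 \<and> s 0 = xs ! 0"
        by (intro exI[of _ "input xs"] conjI runs_Skip) (simp add: input_def)
    qed (auto intro: poly_bounded_const)
    show "polytime_fun2 (\<lambda>x u. fst (decode [] (tl u)))" unfolding polytime_fun2_def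
    proof (rule polytimeI[where c = "Seq (clear 0) (Seq (Pop 1) (decode_program 1 0))" and T = "\<lambda>n. 7 * n + 20"])
      show "poly_bounded (\<lambda>n. 7 * n + 20)"
        by (intro poly_bounded_add poly_bounded_mult poly_bounded_const poly_bounded_id)
      fix xs :: "bits list" assume "length xs = 2"
      then obtain x u where xs: "xs = [x, u]" by (auto simp: numeral_2_eq_2 length_Suc_conv)
      have "runs {} (Seq (clear 0) (Seq (Pop 1) (decode_program 1 0))) (input [x, u])
          (input [fst (decode [] (tl u)), snd (decode [] (tl u))]) (7 * (length x + length u) + 20)"
        by (rule runs_weaken[OF runs_Seq[OF runs_clear runs_Seq[OF runs_Pop runs_decode]]])
           (auto simp: input_def fun_eq_iff less_Suc_eq)
      then show "\<exists>s. runs {} (Seq (clear 0) (Seq (Pop 1) (decode_program 1 0))) (input xs) s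
          (7 * sum_list (map length xs) + 20) \<and> s 0 = fst (decode [] (tl (xs ! 1)))"
        unfolding xs by (intro exI[of _ "input [fst (decode [] (tl u)), snd (decode [] (tl u))]"])
          (auto simp: input_def)
    qed simp
    fix x u assume "S2P_Search Q q x u"
    then show "R x (fst (decode [] (tl u)))"
      \<comment> \<open>A second-player witness cannot occur: it would beat the move provided by
        \<open>win\<close>.\<close>
      using sound win unfolding S2P_Search_def by (metis list.sel(3))
  qed
  ultimately show ?thesis by blast
qed

theorem theorem4:
  shows "(\<forall>P q. S2P_predicate P q \<longrightarrow> TFNP_NP (S2P_Search P q)) \<and>
    (\<forall>R. TFNP_NP R \<longrightarrow>
      (\<exists>Q q. S2P_predicate Q q \<and> search_reduces R (S2P_Search Q q)))"
  using TFNP_NP_S2P_Search TFNP_NP_reduces_to_S2P_Search by blast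

end
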